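(* Let $(\overline{X},\overline{f})$ be an orientable branched solenoid with an orientable presentation $(X,f)$ and $n\times n$ adjacency matrix $M$, where $n$ is the number of edges of $X$. Then the map $$\iota\colon\left(\varinjlim(\mathbb{Z}^n,M),\varinjlim(\mathbb{Z}^n_+,M)\right)\to\left(\mathrm{Br}(\overline{X}),\mathrm{Br}_{\oplus}(\overline{X})\right)$$ described in the context is an epimorphism of ordered groups (a surjective group homomorphism mapping the positive cone into the positive cone). If $(X,f)$ is an elementary presentation, then $\iota$ is an isomorphism of ordered groups.
   Context: **Branched solenoids.** $X$ is a finite directed nondegenerate graph (every vertex has at least one incoming and at least one outgoing edge) with vertex set $\mathcal{V}$ and edge set $\mathcal{E}$; $f\colon X\to X$ is continuous. Consider the axioms: (0) Indecomposability: $(X,f)$ is indecomposable, i.e. $X$ is not the union of two disjoint nonempty closed $f$-invariant sets. (1) Nonwandering: all points of $X$ are nonwandering under $f$. (3) Expansion: there are a metric $d$ compatible with the topology and constants $C>0$, $\lambda>1$ such that for all $n>0$ and all $x,y$ on a common edge, if $f^n$ maps the interval $[x,y]$ into an edge then $d(f^nx,f^ny)\ge C\lambda^n d(x,y)$. (4) Nonfolding: $f^n|_{X-\mathcal{V}}$ is locally one-to-one for every positive integer $n$. (5) Markov: $f(\mathcal{V})\subseteq\mathcal{V}$. Let $\overline{X}=\{(x_0,x_1,\dots)\in\prod_0^\infty X: f(x_{n+1})=x_n\}$ and $\overline{f}(x_0,x_1,\dots)=(f(x_0),x_0,x_1,\dots)$. If $(X,f)$ satisfies axioms (0),(1),(3),(4),(5),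 then $\overline{X}$ is a branched solenoid with presentation $(X,f)$. The presentation, and the branched solenoid, is orientable if the edges of $X$ can be (and are) directed so that $f$ is orientation preserving. The presentation is elementary if $X$ is a wedge of circles and $f$ fixes its unique branch point. **Orientation.** A directed edge $e$ is parameterized as $e(t)$, $t\in[0,1]$, from $e(0)$ to $e(1)$ (possibly equal). A continuous path $p$ in a directed graph is orientation preserving if $e^{-1}\circ p$ is increasing on every interval that $p$ maps into a directed edge $e$. $f$ is orientation preserving if it sends orientation preserving paths to orientation preserving paths. $\overline{X}$ is oriented by the directions of the edges of $X$: with $\pi_k\colon\overline{X}\to X$ the $k$-th coordinate projection, a locally one-to-one curve $\gamma$ in $\overline{X}$ is orientation preserving iff $\pi_k\circ\gamma$ is orientation preserving for all $k$. **Adjacency matrix.** For $e_i\in\mathcal{E}$, $f(e_i)$ is a path of edges; $M(i,j)$ is the number of times it covers $e_j$ (ignoring direction). $\varinjlim(\mathbb{Z}^n,M)$ is the direct limit of $\mathbb{Z}^n\xrightarrow{M}\mathbb{Z}^n\xrightarrow{M}\cdots$, with positive cone $\varinjlim(\mathbb{Z}^n_+,M)$ the union of the images of the copies of $\mathbb{Z}^n_+$ (nonnegative vectors). **Bruschlinsky group and winding order.** For compact metric $Y$, $C(Y,S^1)$ is the group of continuous maps $Y\to S^1$, $R(Y)=\{\exp(2\pi i g):g\in C(Y,\mathbb{R})\}$, $\mathrm{Br}(Y)=C(Y,S^1)/R(Y)$. $\mathrm{Br}_{\oplus}(\overline{X})$ is the set of $[\phi]$ for which there is $\psi\in R(\overline{X})$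 such that, for every orientation preserving parameterized curve $\gamma\colon\mathbb{R}\to\overline{X}$, $(\phi\cdot\psi)(\gamma(t))$ does not move clockwise on $S^1$ as $t$ increases. **The map $\iota$.** Identify $\mathbb{Z}^n$ with $C(\mathcal{E},\mathbb{Z})$ (integer-valued functions on $\mathcal{E}$). For $g\in C(\mathcal{E},\mathbb{Z})$ let $\phi_g\colon X\to S^1$, $\phi_g(e(t))=\exp(2\pi i\,t\,g(e))$. $\iota$ sends the class of $g$ in the $k$-th copy of $\mathbb{Z}^n$ ($k\ge 0$) to $[\phi_g\circ\pi_k]$. *)

theory Defs
  imports "HOL-Analysis.Analysis" "HOL-Algebra.Coset"
begin

section \<open>Finite directed graphs\<close>

text \<open>
  A finite directed graph is a Hausdorff space \<open>X\<close> with a finite vertex set \<open>V\<close> and edges indexed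
  by a finite type, the edge \<open>e\<close> being parameterized by \<open>c e\<close> on \<open>{0..1}\<close>. Loops and multiple edges
  are allowed. The Hausdorff condition together with \<open>space\<close> forces \<open>X\<close> to carry the quotient
  topology of the disjoint union of the closed edges, so \<open>X\<close> is compact and metrizable.
\<close>

locale finite_digraph =
  fixes X :: "'a topology" and V :: "'a set" and c :: "'e::finite \<Rightarrow> real \<Rightarrow> 'a"
  assumes Hausdorff: "Hausdorff_space X"
    and finite_V: "finite V"
    and continuous_edge: "\<And>e. continuous_map (top_of_set {0..1}) X (c e)"
    and edge_ends: "\<And>e. c e 0 \<in> V" "\<And>e. c e 1 \<in> V"
    and inj_edge: "\<And>e. inj_on (c e) {0<..<1}"
    and edge_avoids_V: "\<And>e. c e ` {0<..<1} \<inter> V = {}"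
    and edges_disjoint: "\<And>e e'. e \<noteq> e' \<Longrightarrow> c e ` {0<..<1} \<inter> c e' ` {0<..<1} = {}"
    and space: "topspace X = V \<union> (\<Union>e. c e ` {0..1})"

locale nondegenerate_digraph = finite_digraph +
  assumes incoming: "\<And>v. v \<in> V \<Longrightarrow> \<exists>e. c e 1 = v"
    and outgoing: "\<And>v. v \<in> V \<Longrightarrow> \<exists>e. c e 0 = v"

text \<open>
  \<open>h\<close> is a continuous branch of \<open>e\<^sup>-\<^sup>1 \<circ> p\<close> on \<open>J\<close>. If \<open>c e 0 \<noteq> c e 1\<close>, such an \<open>h\<close> exists
  iff \<open>p\<close> is continuous on \<open>J\<close> and maps \<open>J\<close> into the closed edge \<open>e\<close>, and it is then unique. For a
  loop, \<open>e\<^sup>-\<^sup>1\<close> is two-valued at the vertex, and \<open>h\<close> does not exist if \<open>p\<close> crosses the vertex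
  from the end of \<open>e\<close> to its beginning.
\<close>

definition edge_lift :: "('e \<Rightarrow> real \<Rightarrow> 'a) \<Rightarrow> 'e \<Rightarrow> real set \<Rightarrow> (real \<Rightarrow> 'a) \<Rightarrow> (real \<Rightarrow> real) \<Rightarrow> bool"
  where "edge_lift c e J p h \<longleftrightarrow>
    continuous_on J h \<and> h ` J \<subseteq> {0..1} \<and> (\<forall>t\<in>J. p t = c e (h t))"

definition locally_one_to_one :: "'a topology \<Rightarrow> ('a \<Rightarrow> 'b) \<Rightarrow> bool"
  where "locally_one_to_one T p \<longleftrightarrow> (\<forall>x\<in>topspace T. \<exists>U. openin T U \<and> x \<in> U \<and> inj_on p U)"


section \<open>Branched solenoids\<close>

definition indecomposable :: "'a topology \<Rightarrow> ('a \<Rightarrow> 'a) \<Rightarrow> bool"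
  where "indecomposable X f \<longleftrightarrow>
    \<not> (\<exists>A B. closedin X A \<and> closedin X B \<and> A \<noteq> {} \<and> B \<noteq> {} \<and> A \<inter> B = {} \<and>
         A \<union> B = topspace X \<and> f ` A \<subseteq> A \<and> f ` B \<subseteq> B)"

definition all_nonwandering :: "'a topology \<Rightarrow> ('a \<Rightarrow> 'a) \<Rightarrow> bool"
  where "all_nonwandering X f \<longleftrightarrow>
    (\<forall>x\<in>topspace X. \<forall>U. openin X U \<and> x \<in> U \<longrightarrow> (\<exists>n>0. (f ^^ n) ` U \<inter> U \<noteq> {}))"

text \<open>
  On a loop the distance between two points of the edge has to be measured along the edge:
  if an interval \<open>[x, y]\<close> with \<open>x \<noteq> y\<close> is mapped once around a loop, then its end points have
  the same image, so no metric on \<open>X\<close> itself can satisfy the inequality for it. Hence \<open>D e\<close> is a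
  metric on the parameter interval of \<open>e\<close>. It is the restriction of the metric \<open>d\<close> of \<open>X\<close> if \<open>e\<close>
  is not a loop, and agrees with \<open>d\<close> for nearby parameters if \<open>e\<close> is a loop. The interval
  \<open>[x, y]\<close> is \<open>c e ` {s..t}\<close>, with end points \<open>x = c e s\<close> and \<open>y = c e t\<close>.
\<close>

definition expanding :: "'a topology \<Rightarrow> ('e \<Rightarrow> real \<Rightarrow> 'a) \<Rightarrow> ('a \<Rightarrow> 'a) \<Rightarrow> bool"
  where "expanding X c f \<longleftrightarrow>
    (\<exists>d D. Metric_space (topspace X) d \<and> Metric_space.mtopology (topspace X) d = X \<and>
      (\<forall>e. Metric_space {0..1} (D e) \<and>
           Metric_space.mtopology {0..1} (D e) = top_of_set {0..1}) \<and>
      (\<exists>\<epsilon>>0. \<forall>e. \<forall>s\<in>{0..1}. \<forall>t\<in>{0..1}.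
           c e 0 \<noteq> c e 1 \<or> \<bar>s - t\<bar> < \<epsilon> \<longrightarrow> D e s t = d (c e s) (c e t)) \<and>
      (\<exists>C>0. \<exists>lam>1. \<forall>n>0. \<forall>e e' s t h.
           0 \<le> s \<and> s \<le> t \<and> t \<le> 1 \<and> edge_lift c e' {s..t} (\<lambda>u. (f ^^ n) (c e u)) h \<longrightarrow>
           D e' (h s) (h t) \<ge> C * lam ^ n * D e s t))"

definition nonfolding :: "'a topology \<Rightarrow> 'a set \<Rightarrow> ('a \<Rightarrow> 'a) \<Rightarrow> bool"
  where "nonfolding X V f \<longleftrightarrow>
    (\<forall>n>0. locally_one_to_one (subtopology X (topspace X - V)) (f ^^ n))"

locale solenoid_presentation = nondegenerate_digraph +
  fixes f :: "'a \<Rightarrow> 'a"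
  assumes continuous_f: "continuous_map X X f"
    and indecomposable: "indecomposable X f"
    and nonwandering: "all_nonwandering X f"
    and expansion: "expanding X c f"
    and nonfolding: "nonfolding X V f"
    and Markov: "f ` V \<subseteq> V"

definition inverse_limit :: "'a topology \<Rightarrow> ('a \<Rightarrow> 'a) \<Rightarrow> (nat \<Rightarrow> 'a) topology"
  where "inverse_limit X f =
    subtopology (product_topology (\<lambda>_. X) UNIV) {x. \<forall>n. f (x (Suc n)) = x n}"

definition induced_shift :: "('a \<Rightarrow> 'a) \<Rightarrow> (nat \<Rightarrow> 'a) \<Rightarrow> (nat \<Rightarrow> 'a)"
  where "induced_shift f x = (\<lambda>n. case n of 0 \<Rightarrow> f (x 0) | Suc m \<Rightarrow> x m)"

definition branched_solenoid ::
  "(nat \<Rightarrow> 'a) topology \<Rightarrow> ((nat \<Rightarrow> 'a) \<Rightarrow> (nat \<Rightarrow> 'a)) \<Rightarrow>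
   'a topology \<Rightarrow> 'a set \<Rightarrow> ('e::finite \<Rightarrow> real \<Rightarrow> 'a) \<Rightarrow> ('a \<Rightarrow> 'a) \<Rightarrow> bool"
  where "branched_solenoid Xbar fbar X V c f \<longleftrightarrow>
    solenoid_presentation X V c f \<and> Xbar = inverse_limit X f \<and> fbar = induced_shift f"

text \<open>A wedge of circles is a graph with a single vertex: then every edge is a loop.\<close>

definition elementary :: "'a set \<Rightarrow> ('a \<Rightarrow> 'a) \<Rightarrow> bool"
  where "elementary V f \<longleftrightarrow> (\<exists>v. V = {v} \<and> f v = v)"


section \<open>Orientation\<close>

definition op_path :: "'a topology \<Rightarrow> ('e \<Rightarrow> real \<Rightarrow> 'a) \<Rightarrow> real set \<Rightarrow> (real \<Rightarrow> 'a) \<Rightarrow> bool"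
  where "op_path X c S p \<longleftrightarrow> continuous_map (top_of_set S) X p \<and>
    (\<forall>J e h. is_interval J \<and> J \<subseteq> S \<and> edge_lift c e J p h \<longrightarrow> strict_mono_on J h)"

text \<open>
  The given directions of the edges are those for which the presentation is oriented.
\<close>

definition orientation_preserving :: "'a topology \<Rightarrow> ('e \<Rightarrow> real \<Rightarrow> 'a) \<Rightarrow> ('a \<Rightarrow> 'a) \<Rightarrow> bool"
  where "orientation_preserving X c f \<longleftrightarrow>
    (\<forall>p. op_path X c {0..1} p \<longrightarrow> op_path X c {0..1} (f \<circ> p))"

definition op_curve ::
  "(nat \<Rightarrow> 'a) topology \<Rightarrow> 'a topology \<Rightarrow> ('e \<Rightarrow> real \<Rightarrow> 'a) \<Rightarrow> (real \<Rightarrow> nat \<Rightarrow> 'a) \<Rightarrow> bool"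
  where "op_curve Xbar X c \<gamma> \<longleftrightarrow>
    continuous_map euclideanreal Xbar \<gamma> \<and> locally_one_to_one euclideanreal \<gamma> \<and>
    (\<forall>k. op_path X c UNIV (\<lambda>t. \<gamma> t k))"


section \<open>The adjacency matrix and its direct limit\<close>

text \<open>
  Each passage of the path \<open>f \<circ> e\<^sub>i\<close> over \<open>e\<^sub>j\<close> (in either direction) is given by an interval
  \<open>{a<..<b}\<close> of parameters that is mapped bijectively onto the interior of \<open>e\<^sub>j\<close>.
\<close>

definition adjacency_matrix :: "('e::finite \<Rightarrow> real \<Rightarrow> 'a) \<Rightarrow> ('a \<Rightarrow> 'a) \<Rightarrow> int ^ 'e ^ 'e"
  where "adjacency_matrix c f = (\<chi> i j. int (card
    {(a, b). 0 \<le> a \<and> a < b \<and> b \<le> 1 \<and>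
       bij_betw (\<lambda>t. f (c i t)) {a<..<b} (c j ` {0<..<1})}))"

text \<open>
  The bonding map is \<open>g \<mapsto> M *v g\<close> on columns, that is, on functions on the edges: if \<open>f\<close> preserves
  orientation, then the map with winding numbers \<open>g\<close>, composed with \<open>f\<close>, winds
  \<open>\<Sum>j. M $ i $ j * g $ j\<close> times along \<open>e\<^sub>i\<close>.
\<close>

definition limit_rel :: "int ^ 'e ^ 'e \<Rightarrow> ((nat \<times> (int ^ 'e::finite)) \<times> (nat \<times> (int ^ 'e))) set"
  where "limit_rel M = {((k, g), (l, h)). \<exists>m n. k + m = l + n \<and>
    ((\<lambda>v. M *v v) ^^ m) g = ((\<lambda>v. M *v v) ^^ n) h}"

definition limit_class :: "int ^ 'e ^ 'e \<Rightarrow> nat \<Rightarrow> int ^ 'e::finite \<Rightarrow> (nat \<times> (int ^ 'e)) set"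
  where "limit_class M k g = limit_rel M `` {(k, g)}"

text \<open>
  In \<open>mult\<close>, the representatives in the \<open>k\<close>-th and the \<open>l\<close>-th copy are first moved to the
  \<open>(k + l)\<close>-th copy; all members of the union are equal.
\<close>

definition limit_group :: "int ^ 'e ^ 'e \<Rightarrow> (nat \<times> (int ^ 'e::finite)) set monoid"
  where "limit_group M =
    \<lparr>carrier = UNIV // limit_rel M,
     mult = (\<lambda>A B. \<Union>(k, g)\<in>A. \<Union>(l, h)\<in>B.
       limit_class M (k + l) (((\<lambda>v. M *v v) ^^ l) g + ((\<lambda>v. M *v v) ^^ k) h)),
     one = limit_class M 0 0\<rparr>"

definition limit_cone :: "int ^ 'e ^ 'e \<Rightarrow> (nat \<times> (int ^ 'e::finite)) set set"
  where "limit_cone M = {limit_class M k g | k g. \<forall>i. 0 \<le> g $ i}"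


section \<open>The Bruschlinsky group and the winding order\<close>

definition circle_maps :: "'y topology \<Rightarrow> ('y \<Rightarrow> complex) monoid"
  where "circle_maps Y =
    \<lparr>carrier = {\<phi> \<in> extensional (topspace Y). continuous_map Y (top_of_set (sphere 0 1)) \<phi>},
     mult = (\<lambda>\<phi> \<psi>. \<lambda>y\<in>topspace Y. \<phi> y * \<psi> y),
     one = (\<lambda>y\<in>topspace Y. 1)\<rparr>"

definition exp_maps :: "'y topology \<Rightarrow> ('y \<Rightarrow> complex) set"
  where "exp_maps Y = {\<lambda>y\<in>topspace Y. cis (2 * pi * g y) | g. continuous_map Y euclideanreal g}"

definition Br :: "'y topology \<Rightarrow> ('y \<Rightarrow> complex) set monoid"
  where "Br Y = circle_maps Y Mod exp_maps Y"

definition Br_class :: "'y topology \<Rightarrow> ('y \<Rightarrow> complex) \<Rightarrow> ('y \<Rightarrow> complex) set"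
  where "Br_class Y \<phi> = exp_maps Y #>\<^bsub>circle_maps Y\<^esub> restrict \<phi> (topspace Y)"

definition never_clockwise :: "(real \<Rightarrow> complex) \<Rightarrow> bool"
  where "never_clockwise p \<longleftrightarrow>
    (\<exists>\<theta>. continuous_on UNIV \<theta> \<and> mono \<theta> \<and> (\<forall>t::real. p t = cis (2 * pi * \<theta> t)))"

definition Br_cone ::
  "(nat \<Rightarrow> 'a) topology \<Rightarrow> 'a topology \<Rightarrow> ('e \<Rightarrow> real \<Rightarrow> 'a) \<Rightarrow> ((nat \<Rightarrow> 'a) \<Rightarrow> complex) set set"
  where "Br_cone Xbar X c = {Br_class Xbar \<phi> | \<phi>. \<phi> \<in> carrier (circle_maps Xbar) \<and>
    (\<exists>\<psi>\<in>exp_maps Xbar. \<forall>\<gamma>. op_curve Xbar X c \<gamma> \<longrightarrow>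
       never_clockwise (\<lambda>t. (\<phi> \<otimes>\<^bsub>circle_maps Xbar\<^esub> \<psi>) (\<gamma> t)))}"


section \<open>The map from the direct limit to the Bruschlinsky group\<close>

definition winding_map :: "('e::finite \<Rightarrow> real \<Rightarrow> 'a) \<Rightarrow> int ^ 'e \<Rightarrow> 'a \<Rightarrow> complex"
  where "winding_map c g x =
    (THE z. \<exists>e. \<exists>t\<in>{0..1}. x = c e t \<and> z = cis (2 * pi * (t * of_int (g $ e))))"

lemma (in finite_digraph) winding_map_edge:
  assumes "t \<in> {0..1}"
  shows "winding_map c g (c e t) = cis (2 * pi * (t * of_int (g $ e)))"
proof -
  have one: "cis (2 * pi * (t * of_int (g $ e))) = 1" if "t = 0 \<or> t = 1" for t e
    using that by (auto simp: cis_multiple_2pi)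
  have "cis (2 * pi * (s * of_int (g $ e'))) = cis (2 * pi * (t * of_int (g $ e)))"
    if s: "s \<in> {0..1}" and eq: "c e t = c e' s" for e' s
  proof (cases "c e t \<in> V")
    case True
    have "t \<notin> {0<..<1}" "s \<notin> {0<..<1}"
      using True eq edge_avoids_V by (metis IntI emptyE imageI)+
    then have "t = 0 \<or> t = 1" "s = 0 \<or> s = 1"
      using s assms by auto
    then show ?thesis by (simp add: one)
  next
    case False
    then have "t \<noteq> 0" "t \<noteq> 1" "s \<noteq> 0" "s \<noteq> 1"
      using edge_ends eq by metis+
    then have ts: "t \<in> {0<..<1}" "s \<in> {0<..<1}"
      using s assms by auto
    then have "e' = e"
      using edges_disjoint[of e' e] eq by (metis IntI emptyE imageI)
    moreover from this have "s = t"
      using ts eq inj_edge[of e] by (metis inj_onD)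
    ultimately show ?thesis by simp
  qed
  then show ?thesis
    unfolding winding_map_def using assms by (intro the_equality) blast+
qed

text \<open>The image below is a singleton: the class does not depend on the representative \<open>(k, g)\<close>.\<close>

definition iota ::
  "(nat \<Rightarrow> 'a) topology \<Rightarrow> ('e::finite \<Rightarrow> real \<Rightarrow> 'a) \<Rightarrow> (nat \<times> (int ^ 'e)) set \<Rightarrow>
   ((nat \<Rightarrow> 'a) \<Rightarrow> complex) set"
  where "iota Xbar c A =
    the_elem ((\<lambda>(k, g). Br_class Xbar (\<lambda>x. winding_map c g (x k))) ` A)"


section \<open>Homomorphisms of ordered groups\<close>

definition ordered_group_epi ::
  "('a, 'm) monoid_scheme \<Rightarrow> 'a set \<Rightarrow> ('b, 'n) monoid_scheme \<Rightarrow> 'b set \<Rightarrow> ('a \<Rightarrow> 'b) \<Rightarrow> bool"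
  where "ordered_group_epi G P H Q h \<longleftrightarrow> group_hom G H h \<and> h \<in> epi G H \<and> h ` P \<subseteq> Q"

definition ordered_group_iso ::
  "('a, 'm) monoid_scheme \<Rightarrow> 'a set \<Rightarrow> ('b, 'n) monoid_scheme \<Rightarrow> 'b set \<Rightarrow> ('a \<Rightarrow> 'b) \<Rightarrow> bool"
  where "ordered_group_iso G P H Q h \<longleftrightarrow> group_hom G H h \<and> h \<in> iso G H \<and> h ` P = Q"

end

theory Submission
  imports Defs "HOL-Library.Real_Mod"
begin

text \<open>
  Let \<open>\<Theta>\<close> be the angle along an orientation preserving path of the map that winds once around every
  edge. It is strictly increasing and parameterizes the path by edges, so the map with winding numbers
  \<open>g\<close> composed with \<open>f\<close> has the winding numbers \<open>M g\<close> up to a map that lifts to the reals. This makes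
  \<open>\<iota>\<close> well defined. By compactness, every circle map on the inverse limit is close to one that
  depends on a single coordinate, and two close circle maps differ by a map that lifts to the reals;
  a circle map on the graph is normalized to \<open>1\<close> at the vertices, which leaves the winding numbers of
  the edges. This gives surjectivity. If there is only one vertex, the same approximation shows that
  a class that vanishes on the inverse limit vanishes at a finite stage, where the winding numbers
  of the loops are determined by the class; curves through single edges detect their signs.
\<close>

section \<open>Continuous angles\<close>

lemma cis_2pi_eq_iff: "cis (2 * pi * x) = cis (2 * pi * y) \<longleftrightarrow> x - y \<in> \<int>"
proof -
  have "cis (2 * pi * x) = cis (2 * pi * y) \<longleftrightarrow> cis (2 * pi * (x - y)) = 1"
    by (simp add: right_diff_distrib flip: cis_divide)
  also have "\<dots> \<longleftrightarrow> x - y \<in> \<int>"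
    by (auto simp: cis_eq_1_iff Ints_def)
  finally show ?thesis .
qed

lemma cis_2pi_eq_1_iff: "cis (2 * pi * x) = 1 \<longleftrightarrow> x \<in> \<int>"
  using cis_2pi_eq_iff[of x 0] by simp

lemma exists_continuous_angle:
  fixes p :: "'b::real_normed_vector \<Rightarrow> complex"
  assumes "convex S" "continuous_on S p" "\<And>t. t \<in> S \<Longrightarrow> norm (p t) = 1"
  obtains \<theta> where "continuous_on S \<theta>" "\<And>t. t \<in> S \<Longrightarrow> p t = cis (2 * pi * \<theta> t)"
proof -
  obtain g where g: "continuous_on S g" "\<And>t. t \<in> S \<Longrightarrow> p t = exp (g t)"
    using continuous_logarithm_on_contractible[OF assms(2) convex_imp_contractible[OF assms(1)]] assms(3)
    by (metis norm_zero zero_neq_one)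
  have "p t = cis (2 * pi * (Im (g t) / (2 * pi)))" if "t \<in> S" for t
  proof -
    have "exp (Re (g t)) = 1"
      using g(2)[OF that] assms(3)[OF that] by (metis norm_exp_eq_Re)
    then show ?thesis
      using g(2)[OF that] by (simp add: exp_eq_polar)
  qed
  moreover have "continuous_on S (\<lambda>t. Im (g t) / (2 * pi))"
    by (intro continuous_intros g(1)) auto
  ultimately show ?thesis
    using that by blast
qed

lemma continuous_Ints_valued_constant:
  fixes \<theta> :: "'b::topological_space \<Rightarrow> real"
  assumes "connected S" "continuous_on S \<theta>" "\<And>t. t \<in> S \<Longrightarrow> \<theta> t \<in> \<int>" "s \<in> S" "t \<in> S"
  shows "\<theta> s = \<theta> t"
proof -
  have "\<theta> constant_on S"
  proof (rule continuous_discrete_range_constant[OF assms(1,2)])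
    fix x assume x: "x \<in> S"
    show "\<exists>e>0. \<forall>y. y \<in> S \<and> \<theta> y \<noteq> \<theta> x \<longrightarrow> e \<le> norm (\<theta> y - \<theta> x)"
    proof (intro exI conjI allI impI)
      fix y assume y: "y \<in> S \<and> \<theta> y \<noteq> \<theta> x"
      then have "\<theta> y - \<theta> x \<in> \<int>" "\<theta> y - \<theta> x \<noteq> 0"
        using assms(3) x by auto
      then show "1 \<le> norm (\<theta> y - \<theta> x)"
        using Ints_nonzero_abs_ge1 by force
    qed simp
  qed
  then show ?thesis
    using assms(4,5) by (auto simp: constant_on_def)
qed

lemma angle_difference_constant:
  fixes \<theta> \<theta>' :: "'b::topological_space \<Rightarrow> real"
  assumes "connected S" "continuous_on S \<theta>" "continuous_on S \<theta>'"
    and "\<And>t. t \<in> S \<Longrightarrow> cis (2 * pi * \<theta> t) = cis (2 * pi * \<theta>' t)" "s \<in> S" "t \<in> S"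
  shows "\<theta> s - \<theta> t = \<theta>' s - \<theta>' t"
proof -
  have "\<theta> s - \<theta>' s = \<theta> t - \<theta>' t"
    by (rule continuous_Ints_valued_constant[OF assms(1) _ _ assms(5,6), where \<theta> = "\<lambda>t. \<theta> t - \<theta>' t"])
      (use assms(2,3,4) in \<open>auto intro!: continuous_intros simp: cis_2pi_eq_iff\<close>)
  then show ?thesis by simp
qed

lemma locally_between_Ints:
  fixes \<Theta> :: "real \<Rightarrow> real"
  assumes "continuous_on S \<Theta>" "u \<in> S" "\<Theta> u \<notin> \<int>"
  obtains d i where "d > 0" "\<And>t. t \<in> S \<Longrightarrow> \<bar>t - u\<bar> < d \<Longrightarrow> of_int i < \<Theta> t \<and> \<Theta> t < of_int i + 1"
proof -
  define i where "i = \<lfloor>\<Theta> u\<rfloor>"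
  have "of_int i < \<Theta> u" "\<Theta> u < of_int i + 1"
    using assms(3) frac_gt_0_iff[of "\<Theta> u"] frac_lt_1[of "\<Theta> u"] unfolding i_def frac_def by linarith+
  then have "openin (top_of_set S) (S \<inter> \<Theta> -` {of_int i<..<of_int i + 1})"
    "u \<in> S \<inter> \<Theta> -` {of_int i<..<of_int i + 1}"
    using continuous_openin_preimage_gen[OF assms(1)] assms(2) by auto
  then obtain d where "d > 0" "\<And>t. t \<in> S \<Longrightarrow> dist t u < d \<Longrightarrow> t \<in> S \<inter> \<Theta> -` {of_int i<..<of_int i + 1}"
    unfolding openin_euclidean_subtopology_iff by blast
  then show ?thesis
    using that[of d i] by (auto simp: dist_real_def)
qed

text \<open>
  If the function decreased, it would pass through a non-integer value for a last time, and could
  not be nondecreasing to the right of that point.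
\<close>
lemma mono_on_if_locally_mono_off_Ints:
  fixes \<theta> :: "real \<Rightarrow> real"
  assumes S: "is_interval S" and cont: "continuous_on S \<theta>"
    and loc: "\<And>u. u \<in> S \<Longrightarrow> \<theta> u \<notin> \<int> \<Longrightarrow> \<exists>d>0. \<forall>t\<in>S. u \<le> t \<and> t < u + d \<longrightarrow> \<theta> u \<le> \<theta> t"
  shows "mono_on S \<theta>"
proof (rule mono_onI, rule ccontr)
  fix s t assume st: "s \<in> S" "t \<in> S" "s \<le> t" and "\<not> \<theta> s \<le> \<theta> t"
  then have less: "\<theta> t < \<theta> s" by simp
  have sub: "{s..t} \<subseteq> S"
    using mem_is_interval_1_I[OF S st(1,2)] by auto
  have "\<exists>y. \<theta> t < y \<and> y < \<theta> s \<and> y \<notin> \<int>"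
  proof -
    define z where "z = (\<theta> t + (of_int \<lfloor>\<theta> t\<rfloor> + 1)) / 2"
    define y where "y = min ((\<theta> t + \<theta> s) / 2) z"
    have "\<theta> t < z" "z < of_int \<lfloor>\<theta> t\<rfloor> + 1"
      using real_of_int_floor_add_one_gt[of "\<theta> t"] by (simp_all add: z_def field_simps)
    then have y: "\<theta> t < y" "y < \<theta> s" "y < of_int \<lfloor>\<theta> t\<rfloor> + 1"
      using less by (auto simp: y_def min_less_iff_disj)
    moreover have "of_int \<lfloor>\<theta> t\<rfloor> < y"
      using y(1) by linarith
    ultimately have "y \<notin> \<int>"
      by (auto elim!: Ints_cases)
    with y show ?thesis by blast
  qed
  then obtain y where y: "\<theta> t < y" "y < \<theta> s" "y \<notin> \<int>" by blast
  define A where "A = {s..t} \<inter> \<theta> -` {y..}"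
  have cont': "continuous_on {s..t} \<theta>"
    using cont sub by (rule continuous_on_subset)
  then have "closed A"
    unfolding A_def by (rule continuous_closed_preimage) auto
  moreover have "bounded A"
    unfolding A_def by (rule bounded_subset[OF bounded_closed_interval]) auto
  ultimately have "compact A"
    by (simp add: compact_eq_bounded_closed)
  moreover have "s \<in> A" using st y by (auto simp: A_def)
  ultimately obtain u where u: "u \<in> A" "\<And>x. x \<in> A \<Longrightarrow> x \<le> u"
    using compact_attains_sup by (metis empty_iff)
  have us: "s \<le> u" "u \<le> t" "u \<in> S" "y \<le> \<theta> u"
    using u(1) sub by (auto simp: A_def)
  then have "u < t" using y(1) by (cases "u = t") auto
  have "\<theta> u = y"
  proof (rule ccontr)
    assume "\<theta> u \<noteq> y"
    then have "y < \<theta> u" using us by simp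
    moreover have "continuous_on {u..t} \<theta>"
      using cont' us(1) by (auto intro: continuous_on_subset)
    ultimately obtain w where w: "u \<le> w" "w \<le> t" "\<theta> w = y"
      using IVT2'[of \<theta> t y u] y(1) us(2) by auto
    then have "w \<in> A" using us by (auto simp: A_def)
    then have "w = u" using u(2) w(1) by force
    then show False using w \<open>\<theta> u \<noteq> y\<close> by simp
  qed
  then obtain d where d: "d > 0" "\<And>x. x \<in> S \<Longrightarrow> u \<le> x \<Longrightarrow> x < u + d \<Longrightarrow> \<theta> u \<le> \<theta> x"
    using loc[OF us(3)] y(3) by blast
  define x where "x = min t (u + d / 2)"
  have x: "u < x" "x < u + d" "x \<in> {s..t}"
    using d(1) \<open>u < t\<close> us by (auto simp: x_def)
  then have "y \<le> \<theta> x"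
    using d(2)[of x] sub \<open>\<theta> u = y\<close> by auto
  then have "x \<in> A" using x by (auto simp: A_def)
  then show False using u(2) x(1) by force
qed

section \<open>The topology of a finite digraph\<close>

context finite_digraph
begin

lemma edge_in_space: "t \<in> {0..1} \<Longrightarrow> c e t \<in> topspace X"
  using space by blast

lemma V_subset: "V \<subseteq> topspace X"
  using space by auto

lemma edge_interior_not_V: "0 < t \<Longrightarrow> t < 1 \<Longrightarrow> c e t \<notin> V"
  using edge_avoids_V[of e] by (metis IntI emptyE greaterThanLessThan_iff imageI)

lemma edge_interior_eqD:
  assumes "c e t = c e' t'" "0 < t" "t < 1" "t' \<in> {0..1}"
  shows "e' = e" "t' = t"
proof -
  have "c e' t' \<notin> V"
    using edge_interior_not_V assms by metis
  then have t': "t' \<in> {0<..<1}"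
    using edge_ends assms(4) by (metis atLeastAtMost_iff greaterThanLessThan_iff order_le_less)
  show "e' = e"
    using edges_disjoint[of e' e] assms t' by (metis IntI emptyE greaterThanLessThan_iff imageI)
  then show "t' = t"
    using inj_edge[of e] assms t' by (metis greaterThanLessThan_iff inj_onD)
qed

lemma edge_interior_preimage:
  assumes "x \<in> topspace X" "x \<notin> V"
  obtains e t where "0 < t" "t < 1" "x = c e t"
proof -
  obtain e t where "t \<in> {0..1}" "x = c e t"
    using assms space by auto
  moreover from this have "0 < t" "t < 1"
    using assms(2) edge_ends by (metis atLeastAtMost_iff order_le_less)+
  ultimately show ?thesis
    using that by blast
qed

lemma compact_X: "compact_space X"
proof -
  have "compactin X (c e ` {0..1})" for e
    using image_compactin[OF _ continuous_edge, of "{0..1}" e] by (simp add: compactin_subtopology)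
  moreover have "compactin X V"
    using finite_V V_subset by (simp add: finite_imp_compactin)
  ultimately have "compactin X (V \<union> (\<Union>e\<in>UNIV. c e ` {0..1}))"
    by (intro compactin_Un compactin_Union) auto
  then show ?thesis
    using space by (simp add: compact_space_def)
qed

end

context nondegenerate_digraph
begin

lemma space_eq_edges: "topspace X = (\<Union>e. c e ` {0..1})"
proof -
  have "V \<subseteq> (\<Union>e. c e ` {0..1})"
  proof
    fix v assume "v \<in> V"
    then obtain e where "v = c e 0"
      using outgoing by blast
    then show "v \<in> (\<Union>e. c e ` {0..1})"
      by (intro UN_I[of e]) auto
  qed
  then show ?thesis
    using space by auto
qed

lemma edge_preimage:
  assumes "x \<in> topspace X"
  obtains e t where "0 \<le> t" "t \<le> 1" "x = c e t"
  using assms unfolding space_eq_edges by auto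

lemma continuous_map_from_graph:
  assumes "\<And>e. continuous_map (top_of_set {0..1}) Y (\<lambda>t. H (c e t))"
  shows "continuous_map X Y H"
  unfolding continuous_map_closedin
proof (intro conjI allI impI)
  show "H \<in> topspace X \<rightarrow> topspace Y"
  proof
    fix x assume "x \<in> topspace X"
    then obtain e t where "0 \<le> t" "t \<le> 1" "x = c e t"
      by (rule edge_preimage)
    then show "H x \<in> topspace Y"
      using assms[of e] unfolding continuous_map_def by auto
  qed
  fix C assume C: "closedin Y C"
  have "closedin X (c e ` {t \<in> {0..1}. H (c e t) \<in> C})" for e
  proof -
    have "closedin (top_of_set {0..1}) {t \<in> {0..1}. H (c e t) \<in> C}"
      using closedin_continuous_map_preimage[OF assms C, of e] by simp
    then have "compact {t \<in> {0..1}. H (c e t) \<in> C}"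
      using closedin_compact compact_Icc by blast
    then have "compactin X (c e ` {t \<in> {0..1}. H (c e t) \<in> C})"
      by (intro image_compactin[OF _ continuous_edge]) (auto simp: compactin_subtopology)
    then show ?thesis
      using Hausdorff compactin_imp_closedin by blast
  qed
  then have "closedin X (\<Union>e\<in>UNIV. c e ` {t \<in> {0..1}. H (c e t) \<in> C})"
    by (intro closedin_Union) auto
  moreover have "(\<Union>e\<in>UNIV. c e ` {t \<in> {0..1}. H (c e t) \<in> C}) = {x \<in> topspace X. H x \<in> C}"
    using edge_in_space unfolding space_eq_edges by blast
  ultimately show "closedin X {x \<in> topspace X. H x \<in> C}"
    by simp
qed

lemma winding_map_vertex [simp]:
  assumes "v \<in> V"
  shows "winding_map c g v = 1"
proof -
  obtain e where "c e 0 = v"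
    using outgoing[OF assms] by blast
  then show ?thesis
    using winding_map_edge[of 0 g e] by simp
qed

lemma continuous_winding_map: "continuous_map X (top_of_set (sphere 0 1)) (winding_map c g)"
proof (rule continuous_map_from_graph)
  fix e
  have "continuous_map (top_of_set {0..1}) (top_of_set (sphere 0 1))
          (\<lambda>t. cis (2 * pi * (t * of_int (g $ e))))"
    by (simp add: continuous_map_in_subtopology image_subset_iff_funcset)
      (intro continuous_intros)
  then show "continuous_map (top_of_set {0..1}) (top_of_set (sphere 0 1)) (\<lambda>t. winding_map c g (c e t))"
    by (rule continuous_map_eq) (simp add: winding_map_edge)
qed

lemma norm_winding_map:
  assumes "x \<in> topspace X"
  shows "norm (winding_map c g x) = 1"
proof -
  obtain e t where a: "0 \<le> t" "t \<le> 1" "x = c e t"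
    using assms by (rule edge_preimage)
  then show ?thesis
   unfolding a(3) by (subst winding_map_edge) auto
qed

lemma winding_map_add:
  assumes "x \<in> topspace X"
  shows "winding_map c (g + h) x = winding_map c g x * winding_map c h x"
proof -
  obtain e t where "0 \<le> t" "t \<le> 1" "x = c e t"
    using assms by (rule edge_preimage)
  then show ?thesis
    by (simp add: winding_map_edge cis_mult distrib_left)
qed

lemma real_function_on_graph:
  fixes h :: "'b \<Rightarrow> real \<Rightarrow> real"
  assumes cont: "\<And>e. continuous_on {0..1} (h e)"
    and ends: "\<And>e. h e 0 = a (c e 0)" "\<And>e. h e 1 = a (c e 1)"
  obtains H where "continuous_map X euclideanreal H" "\<And>e t. t \<in> {0..1} \<Longrightarrow> H (c e t) = h e t"
proof -
  define H where "H x = (if x \<in> V then a x else THE y. \<exists>e t. 0 < t \<and> t < 1 \<and> x = c e t \<and> y = h e t)" for x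
  have H: "H (c e t) = h e t" if "t \<in> {0..1}" for e t
  proof (cases "t = 0 \<or> t = 1")
    case True
    then show ?thesis
      by (elim disjE) (simp_all add: H_def ends edge_ends)
  next
    case False
    then have t: "0 < t" "t < 1" using that by auto
    have "(THE y. \<exists>e' t'. 0 < t' \<and> t' < 1 \<and> c e t = c e' t' \<and> y = h e' t') = h e t"
    proof (rule the_equality)
      show "\<exists>e' t'. 0 < t' \<and> t' < 1 \<and> c e t = c e' t' \<and> h e t = h e' t'"
        using t by blast
      fix y assume "\<exists>e' t'. 0 < t' \<and> t' < 1 \<and> c e t = c e' t' \<and> y = h e' t'"
      then obtain e' t' where "0 < t'" "t' < 1" "c e t = c e' t'" "y = h e' t'" by blast
      then show "y = h e t"
        using edge_interior_eqD[of e t e' t'] t by simp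
    qed
    then show ?thesis
      using edge_interior_not_V t by (simp add: H_def)
  qed
  moreover have "continuous_map X euclideanreal H"
  proof (rule continuous_map_from_graph)
    fix e
    have "continuous_map (top_of_set {0..1}) euclideanreal (h e)"
      using cont by simp
    then show "continuous_map (top_of_set {0..1}) euclideanreal (\<lambda>t. H (c e t))"
      by (rule continuous_map_eq) (simp add: H)
  qed
  ultimately show ?thesis
    using that by blast
qed

end

section \<open>Orientation preserving paths\<close>

lemma op_pathD:
  "op_path X c S p \<Longrightarrow> is_interval J \<Longrightarrow> J \<subseteq> S \<Longrightarrow> edge_lift c e J p h \<Longrightarrow> strict_mono_on J h"
  unfolding op_path_def by blast

lemma op_path_continuous: "op_path X c S p \<Longrightarrow> continuous_map (top_of_set S) X p"
  unfolding op_path_def by blast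

lemma continuous_map_top_of_set_subset:
  "continuous_map (top_of_set S) X p \<Longrightarrow> J \<subseteq> S \<Longrightarrow> continuous_map (top_of_set J) X p"
  by (metis continuous_map_from_subtopology inf.absorb2 subtopology_subtopology)

lemma op_path_in_space: "op_path X c S p \<Longrightarrow> t \<in> S \<Longrightarrow> p t \<in> topspace X"
  using continuous_map_image_subset_topspace[OF op_path_continuous, of X c S p] by auto

lemma continuous_map_agree_on_Icc:
  fixes a b :: real
  assumes "Hausdorff_space X" "a < b"
    and "continuous_map (top_of_set {a..b}) X p" "continuous_map (top_of_set {a..b}) X q"
    and "\<And>t. a < t \<Longrightarrow> t < b \<Longrightarrow> p t = q t" "t \<in> {a..b}"
  shows "p t = q t"
proof (rule forall_in_closure_of_eq[OF _ assms(1,3,4)])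
  show "t \<in> top_of_set {a..b} closure_of {a<..<b}"
    using assms(2,6) by (simp add: closure_of_subtopology inf.absorb2 greaterThanLessThan_subseteq_atLeastAtMost_iff)
qed (use assms(5) in auto)

context nondegenerate_digraph
begin

lemma continuous_winding_map_path:
  assumes "continuous_map (top_of_set S) X p"
  shows "continuous_on S (\<lambda>t. winding_map c g (p t))"
  using continuous_map_compose[OF assms continuous_winding_map]
  by (simp add: continuous_map_in_subtopology o_def)

lemma winding_map_1_eq_1_iff:
  assumes "x \<in> topspace X"
  shows "winding_map c 1 x = 1 \<longleftrightarrow> x \<in> V"
proof (cases "x \<in> V")
  case False
  obtain e t where et: "0 < t" "t < 1" "x = c e t"
    using edge_interior_preimage[OF assms False] by metis
  then have "t \<notin> \<int>"
    by (auto elim!: Ints_cases)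
  then show ?thesis
    using False et by (simp add: winding_map_edge cis_2pi_eq_1_iff)
qed simp

lemma angle_of_path:
  fixes S :: "real set"
  assumes "continuous_map (top_of_set S) X p" "convex S"
  obtains \<theta> where "continuous_on S \<theta>" "\<And>t. t \<in> S \<Longrightarrow> winding_map c g (p t) = cis (2 * pi * \<theta> t)"
proof -
  have "norm (winding_map c g (p t)) = 1" if "t \<in> S" for t
    using continuous_map_image_subset_topspace[OF assms(1)] that by (auto intro: norm_winding_map)
  then show ?thesis
    using exists_continuous_angle[OF assms(2) continuous_winding_map_path[OF assms(1), of g]] that by metis
qed

text \<open>
  Off the vertices, the winding map of one edge is \<open>1\<close> or agrees with the winding map of all edges.
  The indicator \<open>r\<close> of these cases is continuous along the path, hence constant.
\<close>
lemma connected_path_in_single_edge: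
  fixes J :: "real set"
  assumes J: "connected J" "u \<in> J" and p: "continuous_map (top_of_set J) X p"
    and off: "\<And>t. t \<in> J \<Longrightarrow> p t \<notin> V"
  obtains e where "\<And>t. t \<in> J \<Longrightarrow> \<exists>s. 0 < s \<and> s < 1 \<and> p t = c e s"
proof -
  have space: "p t \<in> topspace X" if "t \<in> J" for t
    using continuous_map_image_subset_topspace[OF p] that by auto
  obtain e s where es: "0 < s" "s < 1" "p u = c e s"
    using edge_interior_preimage[OF space off] J(2) by metis
  define r where "r t = Re ((winding_map c (axis e 1) (p t) - 1) / (winding_map c 1 (p t) - 1))" for t
  have ne: "winding_map c 1 (p t) \<noteq> 1" if "t \<in> J" for t
    using winding_map_1_eq_1_iff off space that by blast
  have r: "r t = (if e' = e then 1 else 0)" if "t \<in> J" "p t = c e' s" "0 < s" "s < 1" for t e' s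
    using that ne[OF that(1)] by (auto simp: r_def winding_map_edge axis_def)
  have "r t = r u" if "t \<in> J" for t
  proof (rule continuous_Ints_valued_constant[OF J(1) _ _ that J(2)])
    show "continuous_on J r"
      unfolding r_def using ne by (intro continuous_intros continuous_winding_map_path p) auto
    show "r t \<in> \<int>" if "t \<in> J" for t
      by (rule edge_interior_preimage[OF space off, OF that that]) (use r that in auto)
  qed
  moreover have "r u = 1"
    using r es J(2) by simp
  ultimately have 1: "r t = 1" if "t \<in> J" for t
    using that by simp
  have "\<exists>s. 0 < s \<and> s < 1 \<and> p t = c e s" if t: "t \<in> J" for t
  proof -
    obtain e' s where s: "0 < s" "s < 1" "p t = c e' s"
      using edge_interior_preimage[OF space off] t by metis
    then have "e' = e"
      using r[OF t s(3,1,2)] 1[OF t] by (simp split: if_splits)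
    then show ?thesis using s by blast
  qed
  then show ?thesis
    using that by blast
qed

lemma path_coordinate:
  fixes J :: "real set"
  assumes J: "connected J" and p: "continuous_map (top_of_set J) X p"
    and \<Theta>: "\<And>t. t \<in> J \<Longrightarrow> winding_map c 1 (p t) = cis (2 * pi * \<Theta> t)"
    and i: "\<And>t. t \<in> J \<Longrightarrow> of_int i < \<Theta> t \<and> \<Theta> t < of_int i + 1"
  shows "\<exists>e. \<forall>t\<in>J. p t = c e (\<Theta> t - of_int i)"
proof (cases "J = {}")
  case False
  then obtain u where u: "u \<in> J" by blast
  have no_int: "of_int i < x \<Longrightarrow> x < of_int i + 1 \<Longrightarrow> x \<notin> \<int>" for x :: real
    by (auto elim!: Ints_cases)
  have "p t \<notin> V" if "t \<in> J" for t
    using \<Theta>[OF that] i[OF that] no_int[of "\<Theta> t"] winding_map_vertex[of "p t" 1] cis_2pi_eq_1_iff[of "\<Theta> t"]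
    by auto
  then obtain e where e: "\<And>t. t \<in> J \<Longrightarrow> \<exists>s. 0 < s \<and> s < 1 \<and> p t = c e s"
    using connected_path_in_single_edge[OF J u p] by blast
  have "p t = c e (\<Theta> t - of_int i)" if t: "t \<in> J" for t
  proof -
    obtain s where s: "0 < s" "s < 1" "p t = c e s"
      using e[OF t] by blast
    have "cis (2 * pi * s) = cis (2 * pi * \<Theta> t)"
      using \<Theta>[OF t] s by (simp add: winding_map_edge)
    then have "s - \<Theta> t \<in> \<int>"
      by (simp add: cis_2pi_eq_iff)
    then have "s - \<Theta> t + of_int i \<in> \<int>"
      by simp
    moreover have "\<bar>s - \<Theta> t + of_int i\<bar> < 1"
      using s i[OF t] by linarith
    ultimately have "s - \<Theta> t + of_int i = 0"
      using Ints_nonzero_abs_less1 by blast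
    then have "s = \<Theta> t - of_int i"
      by linarith
    then show ?thesis
      using s(3) by (rule subst)
  qed
  then show ?thesis by blast
qed simp

lemma angle_along_edge:
  fixes J :: "real set"
  assumes J: "connected J" and \<theta>: "continuous_on J \<theta>" and \<Theta>: "continuous_on J \<Theta>"
    and lift: "\<And>t. t \<in> J \<Longrightarrow> winding_map c g (p t) = cis (2 * pi * \<theta> t)"
    and p: "\<And>t. t \<in> J \<Longrightarrow> p t = c e (\<Theta> t - k)" "\<And>t. t \<in> J \<Longrightarrow> \<Theta> t - k \<in> {0..1}"
    and st: "s \<in> J" "t \<in> J"
  shows "\<theta> s - \<theta> t = (\<Theta> s - \<Theta> t) * of_int (g $ e)"
proof -
  have "\<theta> s - \<theta> t = (\<Theta> s - k) * of_int (g $ e) - (\<Theta> t - k) * of_int (g $ e)"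
  proof (rule angle_difference_constant[OF J \<theta> _ _ st])
    show "continuous_on J (\<lambda>t. (\<Theta> t - k) * of_int (g $ e))"
      by (intro continuous_intros \<Theta>)
    show "cis (2 * pi * \<theta> t) = cis (2 * pi * ((\<Theta> t - k) * of_int (g $ e)))" if "t \<in> J" for t
      using lift[OF that] p[OF that] winding_map_edge[of "\<Theta> t - k" g e] by simp
  qed
  then show ?thesis
    by (simp add: algebra_simps)
qed

lemma path_in_V_constant:
  fixes J :: "real set"
  assumes J: "connected J" and p: "continuous_map (top_of_set J) X p"
    and V: "\<And>t. t \<in> J \<Longrightarrow> p t \<in> V" and st: "s \<in> J" "t \<in> J"
  shows "p s = p t"
proof -
  obtain a :: "'a \<Rightarrow> nat" where a: "inj_on a V"
    using finite_imp_inj_to_nat_seg[OF finite_V] by blast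
  define h where "h e x = (1 - x) * real (a (c e 0)) + x * real (a (c e 1))" for e x
  obtain H where H: "continuous_map X euclideanreal H" "\<And>e t. t \<in> {0..1} \<Longrightarrow> H (c e t) = h e t"
    by (rule real_function_on_graph[of h "\<lambda>x. real (a x)"])
      (auto simp: h_def intro!: continuous_intros)
  have HV: "H v = real (a v)" if v: "v \<in> V" for v
  proof -
    obtain e where "c e 0 = v"
      using outgoing[OF v] by blast
    then show ?thesis
      using H(2)[of 0 e] by (simp add: h_def)
  qed
  have "H (p s) = H (p t)"
  proof (rule continuous_Ints_valued_constant[OF J _ _ st, where \<theta> = "\<lambda>t. H (p t)"])
    show "continuous_on J (\<lambda>t. H (p t))"
      using continuous_map_compose[OF p H(1)] by (simp add: o_def)
  qed (simp add: HV V)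
  then show ?thesis
    using HV V st a by (simp add: inj_on_eq_iff)
qed

lemma op_path_angle_strict_mono:
  assumes op: "op_path X c S p" and S: "is_interval S" and cont: "continuous_on S \<Theta>"
    and \<Theta>: "\<And>t. t \<in> S \<Longrightarrow> winding_map c 1 (p t) = cis (2 * pi * \<Theta> t)"
  shows "strict_mono_on S \<Theta>"
proof -
  have mono_J: "strict_mono_on J \<Theta>"
    if J: "is_interval J" "J \<subseteq> S" and i: "\<And>t. t \<in> J \<Longrightarrow> of_int i < \<Theta> t \<and> \<Theta> t < of_int i + 1" for J i
  proof -
    have "\<exists>e. \<forall>t\<in>J. p t = c e (\<Theta> t - of_int i)"
      using J op \<Theta> i
      by (intro path_coordinate) (auto simp: is_interval_connected_1 intro: continuous_map_top_of_set_subset op_path_continuous)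
    then obtain e where e: "\<And>t. t \<in> J \<Longrightarrow> p t = c e (\<Theta> t - of_int i)"
      by blast
    have "continuous_on J (\<lambda>t. \<Theta> t - of_int i)"
      using cont J(2) by (intro continuous_intros) (rule continuous_on_subset)
    moreover have "\<Theta> t - of_int i \<in> {0..1}" if "t \<in> J" for t
      using i[OF that] by auto
    ultimately have "edge_lift c e J p (\<lambda>t. \<Theta> t - of_int i)"
      using e by (auto simp: edge_lift_def)
    from op_pathD[OF op J this] show ?thesis
      by (simp add: strict_mono_on_def)
  qed
  have mono: "mono_on S \<Theta>"
  proof (rule mono_on_if_locally_mono_off_Ints[OF S cont])
    fix u assume u: "u \<in> S" "\<Theta> u \<notin> \<int>"
    obtain d i where d: "d > 0" "\<And>t. t \<in> S \<Longrightarrow> \<bar>t - u\<bar> < d \<Longrightarrow> of_int i < \<Theta> t \<and> \<Theta> t < of_int i + 1"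
      using locally_between_Ints[OF cont u] by blast
    have "strict_mono_on (S \<inter> {u - d<..<u + d}) \<Theta>"
      by (rule mono_J[of _ i]) (use S d(2) in \<open>auto simp: is_interval_Int is_interval_oo\<close>)
    then have "\<Theta> u \<le> \<Theta> t" if "t \<in> S" "u \<le> t" "t < u + d" for t
      using strict_mono_onD[of "S \<inter> {u - d<..<u + d}" \<Theta> u t] that u(1) d(1) by (cases "u = t") auto
    then show "\<exists>d>0. \<forall>t\<in>S. u \<le> t \<and> t < u + d \<longrightarrow> \<Theta> u \<le> \<Theta> t"
      using d(1) by blast
  qed
  show ?thesis
  proof (rule strict_mono_onI, rule ccontr)
    fix s t assume st: "s \<in> S" "t \<in> S" "s < t" "\<not> \<Theta> s < \<Theta> t"
    have sub: "{s..t} \<subseteq> S"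
      using mem_is_interval_1_I[OF S st(1,2)] by auto
    have const: "\<Theta> u = \<Theta> s" if "u \<in> {s..t}" for u
    proof -
      have "\<Theta> s \<le> \<Theta> u" "\<Theta> u \<le> \<Theta> t"
        using mono_onD[OF mono, of s u] mono_onD[OF mono, of u t] that sub st by auto
      then show ?thesis using st(4) by simp
    qed
    show False
    proof (cases "\<Theta> s \<in> \<int>")
      case False
      then have "of_int \<lfloor>\<Theta> s\<rfloor> < \<Theta> s"
        using frac_gt_0_iff[of "\<Theta> s"] by (simp add: frac_def)
      then have "of_int \<lfloor>\<Theta> s\<rfloor> < \<Theta> u \<and> \<Theta> u < of_int \<lfloor>\<Theta> s\<rfloor> + 1" if "u \<in> {s..t}" for u
        unfolding const[OF that] by simp
      from mono_J[OF is_interval_cc sub this] have "strict_mono_on {s..t} \<Theta>" .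
      from strict_mono_onD[OF this, of s t] show False
        using st(3,4) by simp
    next
      case True
      have V: "p u \<in> V" if "u \<in> {s..t}" for u
      proof -
        have "u \<in> S" using that sub by blast
        then show ?thesis
          using True const[OF that] \<Theta>[of u] op_path_in_space[OF op]
          by (simp add: winding_map_1_eq_1_iff[symmetric] cis_2pi_eq_1_iff)
      qed
      then obtain e where e: "c e 0 = p s"
        using outgoing[of "p s"] st(3) by auto
      have "p u = c e 0" if "u \<in> {s..t}" for u
        unfolding e by (rule path_in_V_constant[where J = "{s..t}", OF _ _ V that])
          (use st(3) continuous_map_top_of_set_subset[OF op_path_continuous[OF op] sub] in auto)
      then have "edge_lift c e {s..t} p (\<lambda>_. 0)"
        by (auto simp: edge_lift_def)
      then have "strict_mono_on {s..t} (\<lambda>_. 0::real)"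
        using op_pathD[OF op _ sub] by (simp add: is_interval_cc)
      from strict_mono_onD[OF this, of s t] show False
        using st(3) by simp
    qed
  qed
qed

lemma op_path_angle_mono:
  assumes op: "op_path X c S p" and S: "is_interval S" and \<theta>: "continuous_on S \<theta>"
    and lift: "\<And>t. t \<in> S \<Longrightarrow> winding_map c g (p t) = cis (2 * pi * \<theta> t)"
    and g: "\<And>e. 0 \<le> g $ e"
  shows "mono_on S \<theta>"
proof (rule mono_on_if_locally_mono_off_Ints[OF S \<theta>])
  fix u assume u: "u \<in> S" "\<theta> u \<notin> \<int>"
  obtain \<Theta> where \<Theta>: "continuous_on S \<Theta>" "\<And>t. t \<in> S \<Longrightarrow> winding_map c 1 (p t) = cis (2 * pi * \<Theta> t)"
    using angle_of_path[OF op_path_continuous[OF op]] S is_interval_convex_1 by blast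
  have "p u \<notin> V"
    using u lift[OF u(1)] winding_map_vertex[of "p u" g] by (auto simp: cis_2pi_eq_1_iff)
  then have "\<Theta> u \<notin> \<int>"
    using \<Theta>(2)[OF u(1)] op_path_in_space[OF op u(1)]
    by (simp add: winding_map_1_eq_1_iff[symmetric] cis_2pi_eq_1_iff)
  then obtain d i where d: "d > 0" "\<And>t. t \<in> S \<Longrightarrow> \<bar>t - u\<bar> < d \<Longrightarrow> of_int i < \<Theta> t \<and> \<Theta> t < of_int i + 1"
    using locally_between_Ints[OF \<Theta>(1) u(1)] by blast
  define J where "J = S \<inter> {u - d<..<u + d}"
  have J: "connected J" "J \<subseteq> S"
    using S is_interval_Int[OF S is_interval_oo, of "u - d" "u + d"] unfolding J_def
    by (auto intro: is_interval_connected)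
  have i: "of_int i < \<Theta> t \<and> \<Theta> t < of_int i + 1" if "t \<in> J" for t
    using d(2)[of t] that by (auto simp: J_def)
  obtain e where e: "\<And>t. t \<in> J \<Longrightarrow> p t = c e (\<Theta> t - of_int i)"
    using path_coordinate[OF J(1) continuous_map_top_of_set_subset[OF op_path_continuous[OF op] J(2)] \<Theta>(2) i] J(2)
    by blast
  have \<Theta>_mono: "strict_mono_on S \<Theta>"
    by (rule op_path_angle_strict_mono[OF op S \<Theta>])
  have "\<theta> u \<le> \<theta> t" if t: "t \<in> S" "u \<le> t" "t < u + d" for t
  proof -
    have tJ: "t \<in> J"
      using t d(1) by (simp add: J_def)
    have uJ: "u \<in> J"
      using u(1) d(1) by (simp add: J_def)
    have "\<theta> t - \<theta> u = (\<Theta> t - \<Theta> u) * of_int (g $ e)"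
    proof (rule angle_along_edge[OF J(1) _ _ _ e _ tJ uJ])
      show "continuous_on J \<theta>" "continuous_on J \<Theta>"
        using \<theta> \<Theta>(1) J(2) by (auto intro: continuous_on_subset)
      show "\<Theta> x - of_int i \<in> {0..1}" if "x \<in> J" for x
        using i[OF that] by auto
    qed (use lift J(2) in auto)
    moreover have "\<Theta> u \<le> \<Theta> t"
      using strict_mono_on_leD[OF \<Theta>_mono u(1) t(1,2)] .
    ultimately show ?thesis
      using g[of e] by (metis diff_ge_0_iff_ge mult_nonneg_nonneg of_int_0_le_iff)
  qed
  then show "\<exists>d>0. \<forall>t\<in>S. u \<le> t \<and> t < u + d \<longrightarrow> \<theta> u \<le> \<theta> t"
    using d(1) by blast
qed

lemma never_clockwise_winding_map:
  assumes op: "op_path X c UNIV p" and g: "\<And>e. 0 \<le> g $ e"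
  shows "never_clockwise (\<lambda>t. winding_map c g (p t))"
proof -
  obtain \<theta> where \<theta>: "continuous_on UNIV \<theta>" "\<And>t. winding_map c g (p t) = cis (2 * pi * \<theta> t)"
    using angle_of_path[OF op_path_continuous[OF op] convex_UNIV] by (metis UNIV_I)
  have "mono_on UNIV \<theta>"
    by (rule op_path_angle_mono[OF op _ \<theta> g]) auto
  then show ?thesis
    using \<theta> unfolding never_clockwise_def by blast
qed

end

section \<open>Decomposition of a path into edges\<close>

text \<open>
  The path \<open>p\<close> runs through the edges \<open>j 0, \<dots>, j (m - 1)\<close>; the total angle \<open>\<Theta>\<close>, which increases by
  \<open>1\<close> along every edge, is a parameter on \<open>{0..m}\<close> with inverse \<open>T\<close>.
\<close>

locale edge_path = nondegenerate_digraph X V c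
  for X :: "'a topology" and V and c :: "'e::finite \<Rightarrow> real \<Rightarrow> 'a" +
  fixes p :: "real \<Rightarrow> 'a" and m :: nat and j :: "nat \<Rightarrow> 'e" and \<Theta> T :: "real \<Rightarrow> real"
  assumes continuous_p: "continuous_map (top_of_set {0..1}) X p"
    and continuous_\<Theta>: "continuous_on {0..1} \<Theta>"
    and strict_mono_\<Theta>: "strict_mono_on {0..1} \<Theta>"
    and continuous_T: "continuous_on {0..real m} T"
    and \<Theta>_image: "\<And>t. t \<in> {0..1} \<Longrightarrow> \<Theta> t \<in> {0..real m}"
    and T_image: "\<And>x. x \<in> {0..real m} \<Longrightarrow> T x \<in> {0..1}"
    and \<Theta>_T: "\<And>x. x \<in> {0..real m} \<Longrightarrow> \<Theta> (T x) = x"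
    and T_\<Theta>: "\<And>t. t \<in> {0..1} \<Longrightarrow> T (\<Theta> t) = t"
    and p_edge: "\<And>i t. i < m \<Longrightarrow> t \<in> {0..1} \<Longrightarrow> real i \<le> \<Theta> t \<Longrightarrow> \<Theta> t \<le> real i + 1 \<Longrightarrow>
      p t = c (j i) (\<Theta> t - real i)"

lemma (in nondegenerate_digraph) op_path_edge_path:
  assumes op: "op_path X c {0..1} p" and ends: "p 0 \<in> V" "p 1 \<in> V"
  obtains m j \<Theta> T where "edge_path X V c p m j \<Theta> T"
proof -
  note p = op_path_continuous[OF op]
  obtain \<Theta>' where \<Theta>': "continuous_on {0..1} \<Theta>'"
    "\<And>t. t \<in> {0..1} \<Longrightarrow> winding_map c 1 (p t) = cis (2 * pi * \<Theta>' t)"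
    using angle_of_path[OF p convex_real_interval(5)] by blast
  have 0: "\<Theta>' 0 \<in> \<int>"
    using \<Theta>'(2)[of 0] ends by (simp flip: cis_2pi_eq_1_iff)
  define \<Theta> where "\<Theta> t = \<Theta>' t - \<Theta>' 0" for t
  have cont: "continuous_on {0..1} \<Theta>"
    unfolding \<Theta>_def by (intro continuous_intros \<Theta>'(1))
  have lift: "winding_map c 1 (p t) = cis (2 * pi * \<Theta> t)" if "t \<in> {0..1}" for t
    unfolding \<Theta>'(2)[OF that] cis_2pi_eq_iff using 0 by (simp add: \<Theta>_def)
  have mono: "strict_mono_on {0..1} \<Theta>"
    by (rule op_path_angle_strict_mono[OF op is_interval_cc cont lift])
  have "\<Theta> 0 = 0" by (simp add: \<Theta>_def)
  have "\<Theta> 1 \<in> \<int>"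
    using lift[of 1] ends by (simp flip: cis_2pi_eq_1_iff)
  moreover have "0 < \<Theta> 1"
    using strict_mono_onD[OF mono, of 0 1] \<open>\<Theta> 0 = 0\<close> by simp
  ultimately obtain m :: nat where m: "\<Theta> 1 = real m"
    by (metis Ints_cases of_int_0_less_iff of_int_of_nat_eq zero_less_imp_eq_int)
  have image: "\<Theta> ` {0..1} = {0..real m}"
  proof
    have "\<Theta> 0 \<le> \<Theta> t" "\<Theta> t \<le> \<Theta> 1" if "t \<in> {0..1}" for t
      using strict_mono_on_leD[OF mono, of 0 t] strict_mono_on_leD[OF mono, of t 1] that by auto
    then show "\<Theta> ` {0..1} \<subseteq> {0..real m}"
      using \<open>\<Theta> 0 = 0\<close> m by auto
    show "{0..real m} \<subseteq> \<Theta> ` {0..1}"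
    proof
      fix x assume "x \<in> {0..real m}"
      then obtain t where "0 \<le> t" "t \<le> 1" "\<Theta> t = x"
        using IVT'[of \<Theta> 0 x 1] \<open>\<Theta> 0 = 0\<close> m cont by auto
      then show "x \<in> \<Theta> ` {0..1}" by force
    qed
  qed
  define T where "T = inv_into {0..1} \<Theta>"
  have inj: "inj_on \<Theta> {0..1}"
    by (rule strict_mono_on_imp_inj_on[OF mono])
  have T_\<Theta>: "T (\<Theta> t) = t" if "t \<in> {0..1}" for t
    unfolding T_def using inv_into_f_f[OF inj that] .
  have \<Theta>_T: "\<Theta> (T x) = x" if "x \<in> {0..real m}" for x
    unfolding T_def using f_inv_into_f[of x \<Theta> "{0..1}"] that image by simp
  have T_image: "T x \<in> {0..1}" if "x \<in> {0..real m}" for x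
    unfolding T_def using inv_into_into[of x \<Theta> "{0..1}"] that image by simp
  have cont_T: "continuous_on {0..real m} T"
    using continuous_on_inv[OF cont compact_Icc, of T] T_\<Theta> image by simp
  have T_less: "T x < T y" if "x < y" "x \<in> {0..real m}" "y \<in> {0..real m}" for x y
    using strict_mono_on_less[OF mono, of "T x" "T y"] T_image \<Theta>_T that by simp
  have "\<exists>e. \<forall>t\<in>{0..1}. real i \<le> \<Theta> t \<and> \<Theta> t \<le> real i + 1 \<longrightarrow> p t = c e (\<Theta> t - real i)" if i: "i < m" for i
  proof -
    define a b where "a = T (real i)" and "b = T (real i + 1)"
    have i': "real i \<in> {0..real m}" "real i + 1 \<in> {0..real m}"
      using i by auto
    have ab: "a < b" "a \<in> {0..1}" "b \<in> {0..1}"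
      using T_less T_image i' by (auto simp: a_def b_def)
    have sub: "{a..b} \<subseteq> {0..1}"
      using ab by auto
    have between: "real i < \<Theta> t \<and> \<Theta> t < real i + 1" if "a < t" "t < b" for t
    proof -
      have "t \<in> {0..1}" using that ab by auto
      then show ?thesis
        using strict_mono_onD[OF mono, of a t] strict_mono_onD[OF mono, of t b] that ab i' \<Theta>_T
        by (simp add: a_def b_def)
    qed
    have "\<exists>e. \<forall>t\<in>{a<..<b}. p t = c e (\<Theta> t - of_int (int i))"
      by (rule path_coordinate)
        (use sub between in \<open>auto intro!: lift intro: continuous_map_top_of_set_subset[OF p]\<close>)
    then obtain e where e: "\<And>t. a < t \<Longrightarrow> t < b \<Longrightarrow> p t = c e (\<Theta> t - real i)"
      by auto
    have between': "real i \<le> \<Theta> t \<and> \<Theta> t \<le> real i + 1" if "t \<in> {a..b}" for t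
      using between[of t] \<Theta>_T[OF i'(1)] \<Theta>_T[OF i'(2)] that
      by (cases "t = a \<or> t = b") (auto simp: a_def b_def)
    have q: "continuous_map (top_of_set {a..b}) X (\<lambda>t. c e (\<Theta> t - real i))"
    proof -
      have "continuous_on {a..b} (\<lambda>t. \<Theta> t - real i)"
        using cont sub by (intro continuous_intros) (rule continuous_on_subset)
      moreover have "\<Theta> t - real i \<in> {0..1}" if "t \<in> {a..b}" for t
        using between'[OF that] by auto
      ultimately have "continuous_map (top_of_set {a..b}) (top_of_set {0..1}) (\<lambda>t. \<Theta> t - real i)"
        by (simp add: continuous_map_in_subtopology Pi_iff)
      from continuous_map_compose[OF this continuous_edge] show ?thesis
        by (simp add: o_def)
    qed
    have "p t = c e (\<Theta> t - real i)" if t: "t \<in> {0..1}" "real i \<le> \<Theta> t" "\<Theta> t \<le> real i + 1" for t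
    proof (rule continuous_map_agree_on_Icc[OF Hausdorff ab(1) _ q e])
      show "continuous_map (top_of_set {a..b}) X p"
        by (rule continuous_map_top_of_set_subset[OF p sub])
      have "\<Theta> a \<le> \<Theta> t" "\<Theta> t \<le> \<Theta> b"
        using t \<Theta>_T i' by (auto simp: a_def b_def)
      then show "t \<in> {a..b}"
        using strict_mono_on_less_eq[OF mono ab(2) t(1)] strict_mono_on_less_eq[OF mono t(1) ab(3)] by simp
    qed
    then show ?thesis by blast
  qed
  then obtain j where j: "\<And>i t. i < m \<Longrightarrow> t \<in> {0..1} \<Longrightarrow> real i \<le> \<Theta> t \<Longrightarrow> \<Theta> t \<le> real i + 1 \<Longrightarrow>
      p t = c (j i) (\<Theta> t - real i)"
    by metis
  have "edge_path X V c p m j \<Theta> T"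
    by unfold_locales (use p cont mono cont_T image T_image \<Theta>_T T_\<Theta> j in auto)
  then show ?thesis
    using that by blast
qed

context edge_path
begin

lemma T_less:
  assumes "x < y" "x \<in> {0..real m}" "y \<in> {0..real m}"
  shows "T x < T y"
  using strict_mono_on_less[OF strict_mono_\<Theta>, of "T x" "T y"] T_image \<Theta>_T assms by simp

lemma T_0: "T 0 = 0" and T_m: "T (real m) = 1"
proof -
  have "\<not> 0 < T 0"
    using strict_mono_onD[OF strict_mono_\<Theta>, of 0 "T 0"] \<Theta>_T[of 0] \<Theta>_image[of 0] T_image[of 0] by auto
  then show "T 0 = 0"
    using T_image[of 0] by auto
  have "\<not> T (real m) < 1"
    using strict_mono_onD[OF strict_mono_\<Theta>, of "T (real m)" 1] \<Theta>_T[of "real m"] \<Theta>_image[of 1] T_image[of "real m"]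
    by auto
  then show "T (real m) = 1"
    using T_image[of "real m"] by auto
qed

lemma p_T:
  assumes "i < m" "s \<in> {0..1}"
  shows "p (T (real i + s)) = c (j i) s"
proof -
  have "real i + s \<in> {0..real m}"
    using assms by auto
  then show ?thesis
    using p_edge[of i "T (real i + s)"] assms T_image \<Theta>_T by simp
qed

lemma total_angle:
  assumes \<theta>: "continuous_on {0..1} \<theta>"
    and lift: "\<And>t. t \<in> {0..1} \<Longrightarrow> winding_map c g (p t) = cis (2 * pi * \<theta> t)"
  shows "\<theta> 1 - \<theta> 0 = (\<Sum>i<m. of_int (g $ j i))"
proof -
  have "\<theta> (T (real (Suc i))) - \<theta> (T (real i)) = of_int (g $ j i)" if i: "i < m" for i
  proof -
    define J where "J = {T (real i)..T (real (Suc i))}"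
    have i': "real i \<in> {0..real m}" "real (Suc i) \<in> {0..real m}"
      using i by auto
    have less: "T (real i) < T (real (Suc i))"
      using T_less[OF _ i'] by simp
    have sub: "J \<subseteq> {0..1}"
      using T_image[OF i'(1)] T_image[OF i'(2)] by (auto simp: J_def)
    have between: "real i \<le> \<Theta> t \<and> \<Theta> t \<le> real i + 1" if "t \<in> J" for t
      using strict_mono_on_leD[OF strict_mono_\<Theta>, of "T (real i)" t]
        strict_mono_on_leD[OF strict_mono_\<Theta>, of t "T (real (Suc i))"] that sub \<Theta>_T i' T_image
      by (auto simp: J_def)
    have "\<theta> (T (real (Suc i))) - \<theta> (T (real i)) =
      (\<Theta> (T (real (Suc i))) - \<Theta> (T (real i))) * of_int (g $ j i)"
    proof (rule angle_along_edge[where J = J and k = "real i" and p = p])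
      show "continuous_on J \<theta>" "continuous_on J \<Theta>"
        using \<theta> continuous_\<Theta> sub by (auto intro: continuous_on_subset)
      show "p t = c (j i) (\<Theta> t - real i)" if "t \<in> J" for t
        using p_edge[OF i, of t] between[OF that] sub that by blast
      show "\<Theta> t - real i \<in> {0..1}" if "t \<in> J" for t
        using between[OF that] by auto
      show "winding_map c g (p t) = cis (2 * pi * \<theta> t)" if "t \<in> J" for t
        using lift sub that by blast
    qed (use less in \<open>auto simp: J_def\<close>)
    then show ?thesis
      using \<Theta>_T[OF i'(1)] \<Theta>_T[OF i'(2)] by simp
  qed
  then have "(\<Sum>i<m. of_int (g $ j i)) = (\<Sum>i<m. \<theta> (T (real (Suc i))) - \<theta> (T (real i)))"
    by simp
  also have "\<dots> = \<theta> (T (real m)) - \<theta> (T (real 0))"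
    by (rule sum_lessThan_telescope)
  finally show ?thesis
    by (simp add: T_0 T_m)
qed

lemma interior_angle_not_Ints:
  assumes "t \<in> {0..1}" "p t \<notin> V"
  shows "\<Theta> t \<notin> \<int>"
proof
  assume "\<Theta> t \<in> \<int>"
  then obtain z where "\<Theta> t = of_int z"
    by (rule Ints_cases)
  then obtain n :: nat where n: "\<Theta> t = real n" "n \<le> m"
    using \<Theta>_image[OF assms(1)] by (cases z rule: int_cases2) auto
  have "p t \<in> V"
  proof (cases "n < m")
    case True
    then show ?thesis
      using p_edge[of n t] n assms edge_ends by simp
  next
    case False
    have "m \<noteq> 0"
    proof
      assume "m = 0"
      then have "\<Theta> 0 = \<Theta> 1"
        using \<Theta>_image[of 0] \<Theta>_image[of 1] by simp
      then show False
        using strict_mono_onD[OF strict_mono_\<Theta>, of 0 1] by simp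
    qed
    then show ?thesis
      using False p_edge[of "m - 1" t] n assms edge_ends by (simp add: of_nat_diff)
  qed
  then show False
    using assms(2) by simp
qed

lemma passage_iff:
  "0 \<le> a \<and> a < b \<and> b \<le> 1 \<and> bij_betw p {a<..<b} (c e ` {0<..<1}) \<longleftrightarrow>
    (\<exists>i<m. j i = e \<and> a = T (real i) \<and> b = T (real (Suc i)))"
proof
  assume ab: "0 \<le> a \<and> a < b \<and> b \<le> 1 \<and> bij_betw p {a<..<b} (c e ` {0<..<1})"
  then have a01: "a \<in> {0..1}" "b \<in> {0..1}" by auto
  have t01: "t \<in> {0..1}" if "t \<in> {a<..<b}" for t
    using that ab by auto
  have p_in: "\<exists>s. 0 < s \<and> s < 1 \<and> p t = c e s" if "t \<in> {a<..<b}" for t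
    using bij_betw_apply[OF _ that, of p "c e ` {0<..<1}"] ab by auto
  have not_Int: "\<Theta> t \<notin> \<int>" if "t \<in> {a<..<b}" for t
    using interior_angle_not_Ints[OF t01[OF that]] p_in[OF that] edge_interior_not_V by metis
  define u where "u = (a + b) / 2"
  have u: "u \<in> {a<..<b}"
    using ab by (auto simp: u_def field_simps)
  have "0 \<le> \<Theta> u" "\<Theta> u \<le> real m"
    using \<Theta>_image t01 u by auto
  define i where "i = nat \<lfloor>\<Theta> u\<rfloor>"
  have "real i = of_int \<lfloor>\<Theta> u\<rfloor>"
    using \<open>0 \<le> \<Theta> u\<close> by (simp add: i_def)
  moreover have "0 < \<Theta> u - of_int \<lfloor>\<Theta> u\<rfloor>"
    using not_Int[OF u] frac_gt_0_iff[of "\<Theta> u"] by (simp add: frac_def)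
  ultimately have i: "real i < \<Theta> u" "\<Theta> u < real i + 1"
    using real_of_int_floor_add_one_gt[of "\<Theta> u"] by auto
  then have "i < m"
    using \<open>\<Theta> u \<le> real m\<close> by linarith
  then have i': "real i \<in> {0..real m}" "real i + 1 \<in> {0..real m}"
    by auto
  have \<Theta>_less: "\<Theta> s < \<Theta> t \<longleftrightarrow> s < t" if "s \<in> {0..1}" "t \<in> {0..1}" for s t
    using strict_mono_on_less[OF strict_mono_\<Theta> that] .
  have "\<not> \<Theta> a < real i"
  proof
    assume "\<Theta> a < real i"
    then have "a < T (real i)" "T (real i) < u"
      using \<Theta>_less[of a "T (real i)"] \<Theta>_less[of "T (real i)" u] a01 t01[OF u] T_image[OF i'(1)] \<Theta>_T[OF i'(1)] i
      by auto
    then show False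
      using not_Int[of "T (real i)"] u \<Theta>_T[OF i'(1)] by simp
  qed
  moreover have "\<not> real i + 1 < \<Theta> b"
  proof
    assume "real i + 1 < \<Theta> b"
    then have "u < T (real i + 1)" "T (real i + 1) < b"
      using \<Theta>_less[of "T (real i + 1)" b] \<Theta>_less[of u "T (real i + 1)"] a01 t01[OF u] T_image[OF i'(2)] \<Theta>_T[OF i'(2)] i
      by auto
    then show False
      using not_Int[of "T (real i + 1)"] u \<Theta>_T[OF i'(2)] by simp
  qed
  ultimately have ab': "real i \<le> \<Theta> a" "\<Theta> b \<le> real i + 1" by auto
  have p_i: "p t = c (j i) (\<Theta> t - real i) \<and> \<Theta> a < \<Theta> t \<and> \<Theta> t < \<Theta> b" if "t \<in> {a<..<b}" for t
  proof -
    have "\<Theta> a < \<Theta> t" "\<Theta> t < \<Theta> b"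
      using \<Theta>_less a01 t01[OF that] that by auto
    then show ?thesis
      using p_edge[OF \<open>i < m\<close> t01[OF that]] ab' by auto
  qed
  have ji: "j i = e"
  proof -
    obtain s where "0 < s" "s < 1" "p u = c e s"
      using p_in[OF u] by blast
    then show ?thesis
      using edge_interior_eqD(1)[of e s "j i" "\<Theta> u - real i"] p_i[OF u] i by auto
  qed
  have hit: "\<Theta> a - real i < s \<and> s < \<Theta> b - real i" if s: "0 < s" "s < 1" for s
  proof -
    have "c e s \<in> p ` {a<..<b}"
      using ab s by (auto simp: bij_betw_def)
    then obtain t where t: "t \<in> {a<..<b}" "p t = c e s"
      by auto
    then have "\<Theta> t - real i = s"
      using edge_interior_eqD(2)[of e s "j i" "\<Theta> t - real i"] p_i[OF t(1)] s ab' by auto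
    then show ?thesis
      using p_i[OF t(1)] by auto
  qed
  have "\<Theta> a \<le> real i"
  proof (rule ccontr)
    assume "\<not> \<Theta> a \<le> real i"
    moreover have "\<Theta> a < real i + 1"
      using p_i[OF u] i by linarith
    ultimately show False
      using hit[of "\<Theta> a - real i"] by simp
  qed
  moreover have "real i + 1 \<le> \<Theta> b"
  proof (rule ccontr)
    assume "\<not> real i + 1 \<le> \<Theta> b"
    moreover have "real i < \<Theta> b"
      using p_i[OF u] i by linarith
    ultimately show False
      using hit[of "\<Theta> b - real i"] by simp
  qed
  ultimately have "\<Theta> a = real i" "\<Theta> b = real (Suc i)"
    using ab' by auto
  then have "a = T (real i)" "b = T (real (Suc i))"
    using T_\<Theta>[OF a01(1)] T_\<Theta>[OF a01(2)] by auto
  then show "\<exists>i<m. j i = e \<and> a = T (real i) \<and> b = T (real (Suc i))"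
    using ji \<open>i < m\<close> by blast
next
  assume "\<exists>i<m. j i = e \<and> a = T (real i) \<and> b = T (real (Suc i))"
  then obtain i where i: "i < m" "j i = e" and a: "a = T (real i)" and b: "b = T (real (Suc i))"
    by blast
  have i': "real i \<in> {0..real m}" "real (Suc i) \<in> {0..real m}"
    using i by auto
  have ab: "a < b" "a \<in> {0..1}" "b \<in> {0..1}" "\<Theta> a = real i" "\<Theta> b = real (Suc i)"
    using T_less[OF _ i'] T_image i' \<Theta>_T by (auto simp: a b)
  have \<Theta>_between: "t \<in> {0..1} \<and> real i < \<Theta> t \<and> \<Theta> t < real i + 1" if "t \<in> {a<..<b}" for t
    using strict_mono_onD[OF strict_mono_\<Theta>, of a t] strict_mono_onD[OF strict_mono_\<Theta>, of t b] that ab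
    by auto
  have T_between: "T (real i + s) \<in> {a<..<b}" if "s \<in> {0<..<1}" for s
    using T_less[of "real i" "real i + s"] T_less[of "real i + s" "real (Suc i)"] that i' i(1)
    by (auto simp: a b)
  have "bij_betw (\<lambda>t. \<Theta> t - real i) {a<..<b} {0<..<1}"
  proof (rule bij_betw_byWitness[where f' = "\<lambda>s. T (real i + s)"])
    show "\<forall>t\<in>{a<..<b}. T (real i + (\<Theta> t - real i)) = t"
      using T_\<Theta> \<Theta>_between by simp
    show "\<forall>s\<in>{0<..<1}. \<Theta> (T (real i + s)) - real i = s"
      using \<Theta>_T i' by simp
    show "(\<lambda>t. \<Theta> t - real i) ` {a<..<b} \<subseteq> {0<..<1}"
      using \<Theta>_between by force
    show "(\<lambda>s. T (real i + s)) ` {0<..<1} \<subseteq> {a<..<b}"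
      using T_between by blast
  qed
  then have "bij_betw (c e \<circ> (\<lambda>t. \<Theta> t - real i)) {a<..<b} (c e ` {0<..<1})"
    using inj_on_imp_bij_betw[OF inj_edge[of e]] by (rule bij_betw_trans)
  then have "bij_betw p {a<..<b} (c e ` {0<..<1})"
  proof (rule bij_betw_cong[THEN iffD1, rotated])
    show "(c e \<circ> (\<lambda>t. \<Theta> t - real i)) t = p t" if "t \<in> {a<..<b}" for t
      using p_edge[OF i(1), of t] \<Theta>_between[OF that] i(2) by simp
  qed
  then show "0 \<le> a \<and> a < b \<and> b \<le> 1 \<and> bij_betw p {a<..<b} (c e ` {0<..<1})"
    using ab by auto
qed

lemma card_passages:
  "card {(a, b). 0 \<le> a \<and> a < b \<and> b \<le> 1 \<and> bij_betw p {a<..<b} (c e ` {0<..<1})} = card {i. i < m \<and> j i = e}"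
proof -
  have "{(a, b). 0 \<le> a \<and> a < b \<and> b \<le> 1 \<and> bij_betw p {a<..<b} (c e ` {0<..<1})} =
    (\<lambda>i. (T (real i), T (real (Suc i)))) ` {i. i < m \<and> j i = e}"
    unfolding passage_iff by auto
  moreover have "inj_on (\<lambda>i. (T (real i), T (real (Suc i)))) {i. i < m \<and> j i = e}"
  proof (rule inj_onI)
    fix i i' assume i: "i \<in> {i. i < m \<and> j i = e}" "i' \<in> {i. i < m \<and> j i = e}"
      "(T (real i), T (real (Suc i))) = (T (real i'), T (real (Suc i')))"
    then have "\<Theta> (T (real i)) = \<Theta> (T (real i'))"
      by (metis Pair_inject)
    moreover have "\<Theta> (T (real i)) = real i" "\<Theta> (T (real i')) = real i'"
      using i(1,2) by (auto intro: \<Theta>_T)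
    ultimately show "i = i'"
      by simp
  qed
  ultimately show ?thesis
    by (simp add: card_image)
qed

lemma sum_passages:
  "(\<Sum>e\<in>UNIV. int (card {(a, b). 0 \<le> a \<and> a < b \<and> b \<le> 1 \<and> bij_betw p {a<..<b} (c e ` {0<..<1})}) * g e)
    = (\<Sum>i<m. g (j i))"
proof -
  have "(\<Sum>e\<in>UNIV. \<Sum>i\<in>{i \<in> {..<m}. j i = e}. g (j i)) = (\<Sum>i<m. g (j i))"
    by (rule sum.group) auto
  moreover have "(\<Sum>i\<in>{i \<in> {..<m}. j i = e}. g (j i)) = int (card {i. i < m \<and> j i = e}) * g e" for e
    by simp
  ultimately show ?thesis
    by (simp add: card_passages)
qed

end

section \<open>The Bruschlinsky group\<close>

lemma continuous_map_compose_continuous_on: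
  assumes "continuous_map Y euclidean \<phi>" "\<phi> ` topspace Y \<subseteq> S" "continuous_on S F"
  shows "continuous_map Y euclidean (\<lambda>y. F (\<phi> y))"
proof -
  have "continuous_map Y (top_of_set S) \<phi>"
    using assms(1,2) by (auto simp: continuous_map_in_subtopology)
  moreover have "continuous_map (top_of_set S) euclidean F"
    using assms(3) by simp
  ultimately show ?thesis
    using continuous_map_compose[of Y "top_of_set S" \<phi> euclidean F] by (simp add: o_def)
qed

lemma continuous_map_binary:
  assumes "continuous_map Y euclidean \<phi>" "continuous_map Y euclidean \<psi>"
    and "continuous_on UNIV (\<lambda>x. F (fst x) (snd x))"
  shows "continuous_map Y euclidean (\<lambda>y. F (\<phi> y) (\<psi> y))"
proof -
  have "continuous_map Y euclidean (\<lambda>y. (\<phi> y, \<psi> y))"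
    using continuous_map_pairedI[OF assms(1,2)] by simp
  from continuous_map_compose_continuous_on[OF this subset_UNIV assms(3)] show ?thesis
    by simp
qed

lemma continuous_map_mult:
  fixes \<phi> \<psi> :: "'y \<Rightarrow> 'b::real_normed_algebra"
  assumes "continuous_map Y euclidean \<phi>" "continuous_map Y euclidean \<psi>"
  shows "continuous_map Y euclidean (\<lambda>y. \<phi> y * \<psi> y)"
  by (rule continuous_map_binary[OF assms]) (intro continuous_intros)

lemma continuous_map_scaleR:
  fixes \<psi> :: "'y \<Rightarrow> 'b::real_normed_vector"
  assumes "continuous_map Y euclidean \<phi>" "continuous_map Y euclidean \<psi>"
  shows "continuous_map Y euclidean (\<lambda>y. \<phi> y *\<^sub>R \<psi> y)"
  by (rule continuous_map_binary[OF assms]) (intro continuous_intros)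

abbreviation circle_map :: "'y topology \<Rightarrow> ('y \<Rightarrow> complex) \<Rightarrow> bool"
  where "circle_map Y \<equiv> continuous_map Y (top_of_set (sphere 0 1))"

lemma circle_map_iff:
  "circle_map Y \<phi> \<longleftrightarrow> continuous_map Y euclidean \<phi> \<and> (\<forall>y\<in>topspace Y. norm (\<phi> y) = 1)"
  by (auto simp: continuous_map_in_subtopology)

lemma circle_map_mult:
  assumes "circle_map Y \<phi>" "circle_map Y \<psi>"
  shows "circle_map Y (\<lambda>y. \<phi> y * \<psi> y)"
  using assms unfolding circle_map_iff by (auto intro: continuous_map_mult simp: norm_mult)

lemma circle_map_cis:
  assumes "continuous_map Y euclideanreal g"
  shows "circle_map Y (\<lambda>y. cis (2 * pi * g y))"
proof -
  have "continuous_on UNIV (\<lambda>x. cis (2 * pi * x))"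
    by (intro continuous_intros)
  from continuous_map_compose_continuous_on[OF assms subset_UNIV this] show ?thesis
    by (simp add: circle_map_iff)
qed

lemma circle_map_cnj:
  assumes "circle_map Y \<phi>"
  shows "circle_map Y (\<lambda>y. cnj (\<phi> y))"
proof -
  have "continuous_on UNIV cnj"
    by (intro continuous_intros)
  from continuous_map_compose_continuous_on[OF _ subset_UNIV this, of Y \<phi>] show ?thesis
    using assms by (simp add: circle_map_iff)
qed

lemma circle_map_restrict: "circle_map Y \<phi> \<Longrightarrow> circle_map Y (restrict \<phi> (topspace Y))"
  by (auto intro: continuous_map_eq)

lemma carrier_circle_maps_iff:
  "\<phi> \<in> carrier (circle_maps Y) \<longleftrightarrow> \<phi> \<in> extensional (topspace Y) \<and> circle_map Y \<phi>"
  by (simp add: circle_maps_def)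

lemma restrict_in_circle_maps: "circle_map Y \<phi> \<Longrightarrow> restrict \<phi> (topspace Y) \<in> carrier (circle_maps Y)"
  using circle_map_restrict by (simp add: carrier_circle_maps_iff)

lemma mult_circle_maps: "\<phi> \<otimes>\<^bsub>circle_maps Y\<^esub> \<psi> = (\<lambda>y\<in>topspace Y. \<phi> y * \<psi> y)"
  by (simp add: circle_maps_def)

lemma one_circle_maps: "\<one>\<^bsub>circle_maps Y\<^esub> = (\<lambda>y\<in>topspace Y. 1)"
  by (simp add: circle_maps_def)

lemma comm_group_circle_maps: "comm_group (circle_maps Y)"
proof (rule comm_groupI)
  fix \<phi> \<psi> \<xi> assume \<phi>: "\<phi> \<in> carrier (circle_maps Y)" and \<psi>: "\<psi> \<in> carrier (circle_maps Y)"
  show "\<phi> \<otimes>\<^bsub>circle_maps Y\<^esub> \<psi> \<in> carrier (circle_maps Y)"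
    using \<phi> \<psi> unfolding mult_circle_maps
    by (intro restrict_in_circle_maps circle_map_mult) (simp_all add: carrier_circle_maps_iff)
  show "\<phi> \<otimes>\<^bsub>circle_maps Y\<^esub> \<psi> = \<psi> \<otimes>\<^bsub>circle_maps Y\<^esub> \<phi>"
    by (simp add: mult_circle_maps mult.commute)
  show "\<phi> \<otimes>\<^bsub>circle_maps Y\<^esub> \<psi> \<otimes>\<^bsub>circle_maps Y\<^esub> \<xi> = \<phi> \<otimes>\<^bsub>circle_maps Y\<^esub> (\<psi> \<otimes>\<^bsub>circle_maps Y\<^esub> \<xi>)"
    by (auto simp: mult_circle_maps mult.assoc)
next
  show "\<one>\<^bsub>circle_maps Y\<^esub> \<in> carrier (circle_maps Y)"
    unfolding one_circle_maps by (rule restrict_in_circle_maps) simp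
next
  fix \<phi> assume \<phi>: "\<phi> \<in> carrier (circle_maps Y)"
  then have ext: "\<phi> \<in> extensional (topspace Y)" and circ: "circle_map Y \<phi>"
    by (simp_all add: carrier_circle_maps_iff)
  show "\<one>\<^bsub>circle_maps Y\<^esub> \<otimes>\<^bsub>circle_maps Y\<^esub> \<phi> = \<phi>"
    unfolding mult_circle_maps one_circle_maps
    by (rule extensionalityI[OF restrict_extensional ext]) simp
  have "cnj (\<phi> y) * \<phi> y = 1" if "y \<in> topspace Y" for y
    using circ that complex_norm_square[of "\<phi> y"] by (simp add: circle_map_iff mult.commute)
  then have "restrict (\<lambda>y. cnj (\<phi> y)) (topspace Y) \<otimes>\<^bsub>circle_maps Y\<^esub> \<phi> = \<one>\<^bsub>circle_maps Y\<^esub>"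
    unfolding mult_circle_maps one_circle_maps by (intro restrict_ext) simp
  then show "\<exists>\<psi>\<in>carrier (circle_maps Y). \<psi> \<otimes>\<^bsub>circle_maps Y\<^esub> \<phi> = \<one>\<^bsub>circle_maps Y\<^esub>"
    using restrict_in_circle_maps[OF circle_map_cnj[OF circ]] by (rule bexI)
qed

lemma subgroup_exp_maps: "subgroup (exp_maps Y) (circle_maps Y)"
proof -
  interpret comm_group "circle_maps Y"
    by (rule comm_group_circle_maps)
  have carrier: "(\<lambda>y\<in>topspace Y. cis (2 * pi * g y)) \<in> carrier (circle_maps Y)"
    if "continuous_map Y euclideanreal g" for g
    by (rule restrict_in_circle_maps[OF circle_map_cis[OF that]])
  have mult: "(\<lambda>y\<in>topspace Y. cis (2 * pi * g y)) \<otimes>\<^bsub>circle_maps Y\<^esub> (\<lambda>y\<in>topspace Y. cis (2 * pi * h y))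
      = (\<lambda>y\<in>topspace Y. cis (2 * pi * (g y + h y)))" for g h
    unfolding mult_circle_maps by (intro restrict_ext) (simp add: cis_mult distrib_left)
  have zero: "(\<lambda>y\<in>topspace Y. cis (2 * pi * 0)) = \<one>\<^bsub>circle_maps Y\<^esub>"
    by (simp add: one_circle_maps)
  have exp: "(\<lambda>y\<in>topspace Y. cis (2 * pi * g y)) \<in> exp_maps Y" if "continuous_map Y euclideanreal g" for g
    using that unfolding exp_maps_def by blast
  show ?thesis
  proof (rule subgroupI)
    show "exp_maps Y \<subseteq> carrier (circle_maps Y)"
      using carrier unfolding exp_maps_def by blast
    show "exp_maps Y \<noteq> {}"
      using exp[of "\<lambda>_. 0"] by auto
    fix a b assume "a \<in> exp_maps Y" "b \<in> exp_maps Y"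
    then obtain g h where g: "continuous_map Y euclideanreal g" "a = (\<lambda>y\<in>topspace Y. cis (2 * pi * g y))"
      and h: "continuous_map Y euclideanreal h" "b = (\<lambda>y\<in>topspace Y. cis (2 * pi * h y))"
      unfolding exp_maps_def by blast
    show "a \<otimes>\<^bsub>circle_maps Y\<^esub> b \<in> exp_maps Y"
      unfolding g(2) h(2) mult by (intro exp continuous_map_add g(1) h(1))
    have neg: "continuous_map Y euclideanreal (\<lambda>y. - g y)"
      using g(1) by (rule continuous_map_minus)
    have "inv\<^bsub>circle_maps Y\<^esub> a = (\<lambda>y\<in>topspace Y. cis (2 * pi * - g y))"
    proof (rule inv_equality)
      show "(\<lambda>y\<in>topspace Y. cis (2 * pi * - g y)) \<otimes>\<^bsub>circle_maps Y\<^esub> a = \<one>\<^bsub>circle_maps Y\<^esub>"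
        unfolding g(2) mult zero[symmetric] by simp
      show "a \<in> carrier (circle_maps Y)" "(\<lambda>y\<in>topspace Y. cis (2 * pi * - g y)) \<in> carrier (circle_maps Y)"
        unfolding g(2) by (fact carrier[OF g(1)], fact carrier[OF neg])
    qed
    then show "inv\<^bsub>circle_maps Y\<^esub> a \<in> exp_maps Y"
      using exp[OF neg] by simp
  qed
qed

lemma comm_group_Br: "comm_group (Br Y)"
  unfolding Br_def by (rule comm_group.abelian_FactGroup[OF comm_group_circle_maps subgroup_exp_maps])

lemma Br_class_eq_iff:
  assumes "circle_map Y \<phi>" "circle_map Y \<psi>"
  shows "Br_class Y \<phi> = Br_class Y \<psi> \<longleftrightarrow>
    (\<exists>g. continuous_map Y euclideanreal g \<and> (\<forall>y\<in>topspace Y. \<phi> y = \<psi> y * cis (2 * pi * g y)))"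
proof -
  interpret comm_group "circle_maps Y"
    by (rule comm_group_circle_maps)
  interpret E: subgroup "exp_maps Y" "circle_maps Y"
    by (rule subgroup_exp_maps)
  define a b where "a = restrict \<phi> (topspace Y)" and "b = restrict \<psi> (topspace Y)"
  have ab: "a \<in> carrier (circle_maps Y)" "b \<in> carrier (circle_maps Y)"
    using assms unfolding a_def b_def by (auto intro: restrict_in_circle_maps)
  have "Br_class Y \<phi> = Br_class Y \<psi> \<longleftrightarrow> a \<in> exp_maps Y #>\<^bsub>circle_maps Y\<^esub> b"
    unfolding Br_class_def a_def[symmetric] b_def[symmetric]
    using repr_independence[OF _ ab(2) subgroup_exp_maps, of a] rcos_self[OF ab(1) subgroup_exp_maps] by auto
  also have "\<dots> \<longleftrightarrow> (\<exists>g. continuous_map Y euclideanreal g \<and>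
      a = (\<lambda>y\<in>topspace Y. cis (2 * pi * g y)) \<otimes>\<^bsub>circle_maps Y\<^esub> b)"
    unfolding r_coset_def exp_maps_def by auto
  also have "\<dots> \<longleftrightarrow> (\<exists>g. continuous_map Y euclideanreal g \<and> (\<forall>y\<in>topspace Y. \<phi> y = \<psi> y * cis (2 * pi * g y)))"
  proof -
    have "a = (\<lambda>y\<in>topspace Y. cis (2 * pi * g y)) \<otimes>\<^bsub>circle_maps Y\<^esub> b \<longleftrightarrow>
        (\<forall>y\<in>topspace Y. \<phi> y = \<psi> y * cis (2 * pi * g y))" for g
      unfolding mult_circle_maps a_def b_def by (auto simp: restrict_def fun_eq_iff mult.commute)
    then show ?thesis by simp
  qed
  finally show ?thesis .
qed

lemma Br_class_in_carrier:
  assumes "circle_map Y \<phi>"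
  shows "Br_class Y \<phi> \<in> carrier (Br Y)"
proof -
  show ?thesis
    using restrict_in_circle_maps[OF assms] unfolding Br_def Br_class_def FactGroup_def RCOSETS_def by auto
qed

lemma carrier_BrE:
  assumes "A \<in> carrier (Br Y)"
  obtains \<phi> where "circle_map Y \<phi>" "A = Br_class Y \<phi>"
proof -
  obtain \<phi> where "\<phi> \<in> carrier (circle_maps Y)" "A = exp_maps Y #>\<^bsub>circle_maps Y\<^esub> \<phi>"
    using assms unfolding Br_def FactGroup_def RCOSETS_def by auto
  then show ?thesis
    using that[of \<phi>] by (simp add: carrier_circle_maps_iff Br_class_def extensional_restrict)
qed

lemma Br_class_mult:
  assumes "circle_map Y \<phi>" "circle_map Y \<psi>"
  shows "Br_class Y \<phi> \<otimes>\<^bsub>Br Y\<^esub> Br_class Y \<psi> = Br_class Y (\<lambda>y. \<phi> y * \<psi> y)"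
proof -
  interpret normal "exp_maps Y" "circle_maps Y"
    by (rule comm_group.subgroup_imp_normal[OF comm_group_circle_maps subgroup_exp_maps])
  note rcos_sum[OF assms[THEN restrict_in_circle_maps]]
  moreover have "restrict \<phi> (topspace Y) \<otimes>\<^bsub>circle_maps Y\<^esub> restrict \<psi> (topspace Y)
    = restrict (\<lambda>y. \<phi> y * \<psi> y) (topspace Y)"
    unfolding mult_circle_maps by (intro restrict_ext) simp
  ultimately show ?thesis
    by (simp add: Br_def Br_class_def FactGroup_def)
qed

section \<open>The direct limit\<close>

lemma funpow_matrix_add:
  fixes M :: "int ^ 'e::finite ^ 'e"
  shows "((\<lambda>v. M *v v) ^^ n) (g + h) = ((\<lambda>v. M *v v) ^^ n) g + ((\<lambda>v. M *v v) ^^ n) h"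
  by (induction n) (simp_all add: matrix_vector_right_distrib)

lemma funpow_matrix_0: "((\<lambda>v. (M :: int ^ 'e::finite ^ 'e) *v v) ^^ n) 0 = 0"
  by (induction n) simp_all

lemma funpow_shift:
  fixes A :: "'b \<Rightarrow> 'b"
  shows "(A ^^ n) g = (A ^^ m) h \<Longrightarrow> (A ^^ (k + n)) g = (A ^^ (k + m)) h"
  by (simp add: funpow_add)

lemma funpow_funpow:
  fixes A :: "'b \<Rightarrow> 'b"
  shows "(A ^^ n) ((A ^^ m) g) = (A ^^ (n + m)) g"
  by (simp add: funpow_add)

lemma limit_rel_iff:
  "((k, g), (l, h)) \<in> limit_rel M \<longleftrightarrow>
    (\<exists>N. ((\<lambda>v. M *v v) ^^ (l + N)) g = ((\<lambda>v. M *v v) ^^ (k + N)) h)"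
proof
  assume "((k, g), (l, h)) \<in> limit_rel M"
  then obtain m n where mn: "k + m = l + n" "((\<lambda>v. M *v v) ^^ m) g = ((\<lambda>v. M *v v) ^^ n) h"
    unfolding limit_rel_def by blast
  have "((\<lambda>v. M *v v) ^^ (l + m)) g = ((\<lambda>v. M *v v) ^^ (l + n)) h"
    using mn(2) by (rule funpow_shift)
  then show "\<exists>N. ((\<lambda>v. M *v v) ^^ (l + N)) g = ((\<lambda>v. M *v v) ^^ (k + N)) h"
    using mn(1) by metis
next
  assume "\<exists>N. ((\<lambda>v. M *v v) ^^ (l + N)) g = ((\<lambda>v. M *v v) ^^ (k + N)) h"
  then obtain N where "((\<lambda>v. M *v v) ^^ (l + N)) g = ((\<lambda>v. M *v v) ^^ (k + N)) h" ..
  moreover have "k + (l + N) = l + (k + N)" by simp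
  ultimately show "((k, g), (l, h)) \<in> limit_rel M"
    unfolding limit_rel_def by blast
qed

lemma equiv_limit_rel: "equiv UNIV (limit_rel M)"
proof (rule equivI)
  show "refl (limit_rel M)"
    by (rule refl_onI) (auto simp: limit_rel_iff)
  show "sym (limit_rel M)"
  proof (rule symI)
    fix x y assume "(x, y) \<in> limit_rel M"
    then show "(y, x) \<in> limit_rel M"
      by (cases x; cases y) (simp add: limit_rel_iff eq_commute)
  qed
  show "trans (limit_rel M)"
  proof (rule transI)
    fix x y z assume xy: "(x, y) \<in> limit_rel M" and yz: "(y, z) \<in> limit_rel M"
    let ?A = "\<lambda>v. M *v v"
    obtain k g l h m i where x: "x = (k, g)" and y: "y = (l, h)" and z: "z = (m, i)"
      by (metis surj_pair)
    obtain N P where N: "(?A ^^ (l + N)) g = (?A ^^ (k + N)) h" and P: "(?A ^^ (m + P)) h = (?A ^^ (l + P)) i"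
      using xy yz unfolding x y z limit_rel_iff by blast
    have "(?A ^^ (m + P + (l + N))) g = (?A ^^ (m + P + (k + N))) h"
      using N by (rule funpow_shift)
    also have "m + P + (k + N) = k + N + (m + P)" by simp
    also have "(?A ^^ (k + N + (m + P))) h = (?A ^^ (k + N + (l + P))) i"
      using P by (rule funpow_shift)
    finally have "(?A ^^ (m + (P + l + N))) g = (?A ^^ (k + (P + l + N))) i"
      by (simp add: add_ac)
    then show "(x, z) \<in> limit_rel M"
      unfolding x z limit_rel_iff by blast
  qed
qed simp

lemma limit_class_eq_iff: "limit_class M k g = limit_class M l h \<longleftrightarrow> ((k, g), (l, h)) \<in> limit_rel M"
  unfolding limit_class_def using eq_equiv_class_iff[OF equiv_limit_rel] by blast

lemma limit_class_self: "(k, g) \<in> limit_class M k g"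
  unfolding limit_class_def using equiv_class_self[OF equiv_limit_rel] by blast

lemma limit_class_mem: "(l, h) \<in> limit_class M k g \<longleftrightarrow> limit_class M l h = limit_class M k g"
  using limit_class_eq_iff[of M k g l h] unfolding limit_class_def by auto

lemma carrier_limit_groupE:
  assumes "A \<in> carrier (limit_group M)"
  obtains k g where "A = limit_class M k g"
  using assms by (auto simp: limit_group_def limit_class_def elim: quotientE)

lemma limit_class_in_carrier: "limit_class M k g \<in> carrier (limit_group M)"
  by (simp add: limit_group_def limit_class_def quotientI)

lemma limit_class_mult:
  "limit_class M k g \<otimes>\<^bsub>limit_group M\<^esub> limit_class M l h =
    limit_class M (k + l) (((\<lambda>v. M *v v) ^^ l) g + ((\<lambda>v. M *v v) ^^ k) h)"
proof -
  let ?A = "\<lambda>v. M *v v"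
  define S where "S k g l h = limit_class M (k + l) ((?A ^^ l) g + (?A ^^ k) h)" for k g l h
  have "S k' g' l' h' = S k g l h"
    if eq: "(k', g') \<in> limit_class M k g" "(l', h') \<in> limit_class M l h" for k' g' l' h'
  proof -
    obtain N P where N: "(?A ^^ (k + N)) g' = (?A ^^ (k' + N)) g"
      and P: "(?A ^^ (l + P)) h' = (?A ^^ (l' + P)) h"
      using eq unfolding limit_class_mem limit_class_eq_iff limit_rel_iff by blast
    have "(?A ^^ (l + l' + P + (k + N))) g' = (?A ^^ (l + l' + P + (k' + N))) g"
      using N by (rule funpow_shift)
    moreover have "(?A ^^ (k + k' + N + (l + P))) h' = (?A ^^ (k + k' + N + (l' + P))) h"
      using P by (rule funpow_shift)
    ultimately have "(?A ^^ (k + l + (N + P))) ((?A ^^ l') g' + (?A ^^ k') h') =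
        (?A ^^ (k' + l' + (N + P))) ((?A ^^ l) g + (?A ^^ k) h)"
      unfolding funpow_matrix_add funpow_funpow
      by (simp add: add_ac)
    then show ?thesis
      unfolding S_def limit_class_eq_iff limit_rel_iff by blast
  qed
  moreover have "(k, g) \<in> limit_class M k g" "(l, h) \<in> limit_class M l h"
    by (simp_all add: limit_class_self)
  ultimately have "(\<Union>(k, g)\<in>limit_class M k g. \<Union>(l, h)\<in>limit_class M l h. S k g l h) = S k g l h"
    by blast
  then show ?thesis
    by (simp add: limit_group_def S_def)
qed

lemma limit_one: "\<one>\<^bsub>limit_group M\<^esub> = limit_class M 0 0"
  by (simp add: limit_group_def)

lemma comm_group_limit_group: "comm_group (limit_group M)"
proof (rule comm_groupI)
  fix x y assume "x \<in> carrier (limit_group M)" "y \<in> carrier (limit_group M)"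
  then obtain k g l h where x: "x = limit_class M k g" and y: "y = limit_class M l h"
    by (metis carrier_limit_groupE)
  show "x \<otimes>\<^bsub>limit_group M\<^esub> y \<in> carrier (limit_group M)"
    unfolding x y limit_class_mult by (rule limit_class_in_carrier)
  show "x \<otimes>\<^bsub>limit_group M\<^esub> y = y \<otimes>\<^bsub>limit_group M\<^esub> x"
    unfolding x y limit_class_mult by (simp add: add.commute)
  fix z assume "z \<in> carrier (limit_group M)"
  then obtain m i where z: "z = limit_class M m i"
    by (metis carrier_limit_groupE)
  show "x \<otimes>\<^bsub>limit_group M\<^esub> y \<otimes>\<^bsub>limit_group M\<^esub> z = x \<otimes>\<^bsub>limit_group M\<^esub> (y \<otimes>\<^bsub>limit_group M\<^esub> z)"
    unfolding x y z limit_class_mult funpow_matrix_add funpow_funpow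
    by (simp add: add_ac)
next
  fix x assume "x \<in> carrier (limit_group M)"
  then obtain k g where x: "x = limit_class M k g"
    by (metis carrier_limit_groupE)
  show "\<one>\<^bsub>limit_group M\<^esub> \<otimes>\<^bsub>limit_group M\<^esub> x = x"
    unfolding x limit_one limit_class_mult by (simp add: funpow_matrix_0)
  have "limit_class M k (- g) \<otimes>\<^bsub>limit_group M\<^esub> x = \<one>\<^bsub>limit_group M\<^esub>"
    unfolding x limit_one limit_class_mult limit_class_eq_iff limit_rel_iff
      funpow_matrix_add[symmetric]
    by (simp add: funpow_matrix_0)
  then show "\<exists>y\<in>carrier (limit_group M). y \<otimes>\<^bsub>limit_group M\<^esub> x = \<one>\<^bsub>limit_group M\<^esub>"
    using limit_class_in_carrier by blast
qed (simp add: limit_one limit_class_in_carrier)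

section \<open>The inverse limit\<close>

locale compact_surjection =
  fixes X :: "'a topology" and f :: "'a \<Rightarrow> 'a"
  assumes compact_space_X: "compact_space X"
    and Hausdorff_space_X: "Hausdorff_space X"
    and continuous_f: "continuous_map X X f"
    and surj_f: "f ` topspace X = topspace X"
begin

abbreviation "Xbar \<equiv> inverse_limit X f"

lemma f_in_space: "x \<in> topspace X \<Longrightarrow> f x \<in> topspace X"
  using surj_f by blast

lemma funpow_in_space: "x \<in> topspace X \<Longrightarrow> (f ^^ n) x \<in> topspace X"
  by (induction n) (auto intro: f_in_space)

lemma continuous_funpow: "continuous_map X X (f ^^ n)"
proof (induction n)
  case (Suc n)
  then show ?case
    using continuous_map_compose[OF Suc continuous_f] by (simp add: o_def)
qed (simp add: id_def[symmetric])

lemma in_Xbar_iff: "x \<in> topspace Xbar \<longleftrightarrow> (\<forall>n. x n \<in> topspace X) \<and> (\<forall>n. f (x (Suc n)) = x n)"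
  by (auto simp: inverse_limit_def)

lemma coordinate_in_space: "x \<in> topspace Xbar \<Longrightarrow> x n \<in> topspace X"
  by (simp add: in_Xbar_iff)

lemma coordinate_funpow: "x \<in> topspace Xbar \<Longrightarrow> (f ^^ n) (x (k + n)) = x k"
  by (induction n) (simp_all add: in_Xbar_iff funpow_swap1)

lemma coordinate_le: "x \<in> topspace Xbar \<Longrightarrow> k \<le> l \<Longrightarrow> (f ^^ (l - k)) (x l) = x k"
  using coordinate_funpow[of x "l - k" k] by simp

lemma continuous_coordinate: "continuous_map Xbar X (\<lambda>x. x k)"
  unfolding inverse_limit_def
  by (intro continuous_map_from_subtopology continuous_map_product_projection) simp

lemma continuous_map_into_Xbar:
  assumes "\<And>n. continuous_map Y X (\<lambda>y. \<gamma> y n)" "\<And>y n. y \<in> topspace Y \<Longrightarrow> f (\<gamma> y (Suc n)) = \<gamma> y n"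
  shows "continuous_map Y Xbar \<gamma>"
  unfolding inverse_limit_def
  by (rule continuous_map_into_subtopology) (use assms in \<open>auto simp: continuous_map_componentwise_UNIV\<close>)

lemma compact_Xbar: "compact_space Xbar"
proof -
  let ?P = "product_topology (\<lambda>_::nat. X) UNIV"
  let ?E = "\<lambda>n. {x \<in> topspace ?P. f (x (Suc n)) = x n}"
  have "closedin ?P (?E n)" for n
  proof (rule closedin_continuous_maps_eq[OF Hausdorff_space_X])
    show "continuous_map ?P X (\<lambda>x. x n)"
      by (rule continuous_map_product_projection) simp
    have "continuous_map ?P X (\<lambda>x. x (Suc n))"
      by (rule continuous_map_product_projection) simp
    from continuous_map_compose[OF this continuous_f]
    show "continuous_map ?P X (\<lambda>x. f (x (Suc n)))"
      by (simp add: o_def)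
  qed
  then have "closedin ?P (\<Inter>n. ?E n)"
    by (intro closedin_Inter) auto
  moreover have "compact_space ?P"
    using compact_space_X by (simp add: compact_space_product_topology)
  ultimately have "compactin ?P (\<Inter>n. ?E n)"
    by (simp add: closedin_compact_space)
  moreover have "(\<Inter>n. ?E n) = topspace ?P \<inter> {x. \<forall>n. f (x (Suc n)) = x n}"
    by auto
  ultimately have "compactin ?P (topspace ?P \<inter> {x. \<forall>n. f (x (Suc n)) = x n})"
    by (simp only:)
  from compact_space_subtopology[OF this] show ?thesis
    unfolding inverse_limit_def subtopology_restrict .
qed

lemma surj_coordinate:
  assumes "z \<in> topspace X"
  obtains x where "x \<in> topspace Xbar" "x k = z"
proof -
  define r where "r y = (SOME w. w \<in> topspace X \<and> f w = y)" for y
  have r: "r y \<in> topspace X \<and> f (r y) = y" if "y \<in> topspace X" for y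
    unfolding r_def using that surj_f by (intro someI_ex[of "\<lambda>w. w \<in> topspace X \<and> f w = y"]) force
  have r_funpow: "(r ^^ n) z \<in> topspace X" for n
    by (induction n) (use assms r in auto)
  define x where "x n = (if n \<le> k then (f ^^ (k - n)) z else (r ^^ (n - k)) z)" for n
  have "f (x (Suc n)) = x n" for n
  proof (cases "n < k")
    case True
    then have "k - n = Suc (k - Suc n)" by simp
    then show ?thesis
      using True by (simp add: x_def)
  next
    case False
    then have "Suc n - k = Suc (n - k)" by simp
    then show ?thesis
      using False r[OF r_funpow] by (auto simp: x_def)
  qed
  moreover have "x n \<in> topspace X" for n
    using assms by (simp add: x_def funpow_in_space r_funpow)
  ultimately show ?thesis
    using that[of x] by (simp add: in_Xbar_iff x_def)
qed

lemma coordinate_neighbourhood: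
  assumes W: "openin Xbar W" "x \<in> W"
  obtains k u where "continuous_map X euclideanreal u" "\<And>z. z \<in> topspace X \<Longrightarrow> 0 \<le> u z" "0 < u (x k)"
    "\<And>y. y \<in> topspace Xbar \<Longrightarrow> 0 < u (y k) \<Longrightarrow> y \<in> W"
proof -
  let ?P = "product_topology (\<lambda>_::nat. X) UNIV"
  obtain W' where W': "openin ?P W'" "W = W' \<inter> {x. \<forall>n. f (x (Suc n)) = x n}"
    using W(1) unfolding inverse_limit_def openin_subtopology by blast
  then obtain U where U: "finite {i. U i \<noteq> topspace X}" "\<And>i. openin X (U i)" "\<And>i. x i \<in> U i" "Pi\<^sub>E UNIV U \<subseteq> W'"
    using W(2) unfolding openin_product_topology_alt by (auto simp: PiE_iff)
  define F where "F = {i. U i \<noteq> topspace X}"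
  obtain k where k: "\<And>i. i \<in> F \<Longrightarrow> i \<le> k"
    using U(1) finite_nat_set_iff_bounded_le[of F] unfolding F_def by blast
  have x: "x \<in> topspace Xbar"
    using W openin_subset by blast
  define O' where "O' = topspace X \<inter> (\<Inter>i\<in>F. {z \<in> topspace X. (f ^^ (k - i)) z \<in> U i})"
  have "openin X O'"
    unfolding O'_def using U(1,2) openin_continuous_map_preimage[OF continuous_funpow]
    by (intro openin_Int_Inter) (auto simp: F_def)
  moreover have "x k \<in> O'"
    using x coordinate_in_space[OF x] coordinate_le[OF x k] U(3) by (simp add: O'_def)
  moreover have "completely_regular_space X"
    using compact_space_X Hausdorff_space_X
    by (simp add: normal_imp_completely_regular_space compact_Hausdorff_or_regular_imp_normal_space)
  moreover have "closedin X (topspace X - O')" "x k \<in> topspace X - (topspace X - O')"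
    using \<open>openin X O'\<close> \<open>x k \<in> O'\<close> coordinate_in_space[OF x] by auto
  ultimately obtain h where h: "continuous_map X (top_of_set {0..1::real}) h" "h (x k) = 0" "h ` (topspace X - O') \<subseteq> {1}"
    unfolding completely_regular_space_def by blast
  have h01: "h z \<in> {0..1}" if "z \<in> topspace X" for z
    using continuous_map_funspace[OF h(1)] that by auto
  show ?thesis
  proof (rule that[of "\<lambda>z. 1 - h z" k])
    show "continuous_map X euclideanreal (\<lambda>z. 1 - h z)"
      using h(1) by (intro continuous_map_diff) (auto simp: continuous_map_in_subtopology)
    show "0 \<le> 1 - h z" if "z \<in> topspace X" for z
      using h01[OF that] by simp
    show "0 < 1 - h (x k)"
      using h(2) by simp
    fix y assume y: "y \<in> topspace Xbar" "0 < 1 - h (y k)"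
    then have "y k \<in> O'"
      using h(3) coordinate_in_space[OF y(1), of k] by (cases "y k \<in> O'") auto
    then have "y i \<in> U i" for i
      using coordinate_le[OF y(1) k, of i] coordinate_in_space[OF y(1), of i]
      by (cases "i \<in> F") (auto simp: O'_def F_def)
    then have "y \<in> W'"
      using U(4) by (auto simp: PiE_iff)
    then show "y \<in> W"
      using W'(2) y(1) by (simp add: in_Xbar_iff)
  qed
qed

text \<open>
  The approximation is a weighted mean of finitely many values of \<open>\<phi>\<close>, with weights that are
  functions of one coordinate.
\<close>
lemma approximation_by_coordinate:
  fixes \<phi> :: "(nat \<Rightarrow> 'a) \<Rightarrow> 'b::real_normed_vector"
  assumes \<phi>: "continuous_map Xbar euclidean \<phi>" and "0 < \<epsilon>"
  shows "\<exists>K \<psi>. continuous_map X euclidean \<psi> \<and> (\<forall>x\<in>topspace Xbar. norm (\<phi> x - \<psi> (x K)) < \<epsilon>)"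
proof -
  define good where "good x k u \<longleftrightarrow> continuous_map X euclideanreal u \<and> (\<forall>z\<in>topspace X. 0 \<le> u z) \<and>
      0 < u (x k) \<and> (\<forall>y\<in>topspace Xbar. 0 < u (y k) \<longrightarrow> norm (\<phi> y - \<phi> x) < \<epsilon> / 2)" for x k u
  have "\<exists>ku. good x (fst ku) (snd ku)" if x: "x \<in> topspace Xbar" for x
  proof -
    define W where "W = {y \<in> topspace Xbar. \<phi> y \<in> ball (\<phi> x) (\<epsilon> / 2)}"
    have "openin Xbar W"
      unfolding W_def by (rule openin_continuous_map_preimage[OF \<phi>]) simp
    moreover have "x \<in> W"
      using x \<open>0 < \<epsilon>\<close> by (simp add: W_def)
    ultimately obtain k u where "continuous_map X euclideanreal u" "\<And>z. z \<in> topspace X \<Longrightarrow> 0 \<le> u z"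
      "0 < u (x k)" and W: "\<And>y. y \<in> topspace Xbar \<Longrightarrow> 0 < u (y k) \<Longrightarrow> y \<in> W"
      by (rule coordinate_neighbourhood) blast
    moreover have "norm (\<phi> y - \<phi> x) < \<epsilon> / 2" if "y \<in> topspace Xbar" "0 < u (y k)" for y
      using W[OF that] by (simp add: W_def dist_norm norm_minus_commute)
    ultimately have "good x k u"
      unfolding good_def by blast
    then show ?thesis
      by (metis fst_conv snd_conv)
  qed
  then obtain ku where ku: "\<And>x. x \<in> topspace Xbar \<Longrightarrow> good x (fst (ku x)) (snd (ku x))"
    by metis
  define k u where "k x = fst (ku x)" and "u x = snd (ku x)" for x
  have u: "\<And>x. x \<in> topspace Xbar \<Longrightarrow> continuous_map X euclideanreal (u x)"
    "\<And>x z. x \<in> topspace Xbar \<Longrightarrow> z \<in> topspace X \<Longrightarrow> 0 \<le> u x z"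
    "\<And>x. x \<in> topspace Xbar \<Longrightarrow> 0 < u x (x (k x))"
    "\<And>x y. x \<in> topspace Xbar \<Longrightarrow> y \<in> topspace Xbar \<Longrightarrow> 0 < u x (y (k x)) \<Longrightarrow> norm (\<phi> y - \<phi> x) < \<epsilon> / 2"
    using ku unfolding good_def k_def u_def by blast+
  define N where "N x = {y \<in> topspace Xbar. u x (y (k x)) \<in> {0<..}}" for x
  have "openin Xbar (N x)" if "x \<in> topspace Xbar" for x
  proof -
    have "continuous_map Xbar euclideanreal (\<lambda>y. u x (y (k x)))"
      using continuous_map_compose[OF continuous_coordinate u(1)[OF that]] by (simp add: o_def)
    then show ?thesis
      unfolding N_def by (rule openin_continuous_map_preimage) simp
  qed
  moreover have "topspace Xbar \<subseteq> \<Union> (N ` topspace Xbar)"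
    using u(3) by (auto simp: N_def)
  ultimately obtain \<F> where \<F>: "finite \<F>" "\<F> \<subseteq> N ` topspace Xbar" "topspace Xbar \<subseteq> \<Union>\<F>"
    using compactinD[of Xbar "topspace Xbar" "N ` topspace Xbar"] compact_Xbar
    unfolding compact_space_def by blast
  obtain A where A: "finite A" "A \<subseteq> topspace Xbar" "topspace Xbar \<subseteq> \<Union> (N ` A)"
    using finite_subset_image[OF \<F>(1,2)] \<F>(3) by blast
  obtain K where K: "\<And>x. x \<in> A \<Longrightarrow> k x \<le> K"
    using finite_nat_set_iff_bounded_le[of "k ` A"] A(1) by auto
  define v where "v x z = u x ((f ^^ (K - k x)) z)" for x z
  have v_cont: "continuous_map X euclideanreal (v x)" if "x \<in> A" for x
    using continuous_map_compose[OF continuous_funpow u(1)] A(2) that unfolding v_def by (auto simp: o_def)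
  have v_nonneg: "0 \<le> v x z" if "x \<in> A" "z \<in> topspace X" for x z
    using u(2) A(2) that funpow_in_space unfolding v_def by blast
  have v_coord: "v x (y K) = u x (y (k x))" if "x \<in> A" "y \<in> topspace Xbar" for x y
    unfolding v_def using coordinate_le[OF that(2) K[OF that(1)]] by simp
  define S where "S z = (\<Sum>x\<in>A. v x z)" for z
  have S_cont: "continuous_map X euclideanreal S"
    unfolding S_def by (intro continuous_map_sum A(1) v_cont)
  have S_pos: "0 < S z" if z: "z \<in> topspace X" for z
  proof -
    obtain y where y: "y \<in> topspace Xbar" "y K = z"
      using surj_coordinate[OF z] by blast
    then obtain x where x: "x \<in> A" "0 < u x (y (k x))"
      using A(3) by (auto simp: N_def)
    then have "0 < v x z"
      using v_coord y by metis
    then show ?thesis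
      unfolding S_def using A(1) x(1) v_nonneg[OF _ z] by (intro sum_pos2[of _ x]) auto
  qed
  define \<psi> where "\<psi> z = inverse (S z) *\<^sub>R (\<Sum>x\<in>A. v x z *\<^sub>R \<phi> x)" for z
  show ?thesis
  proof (intro exI[of _ K] exI[of _ \<psi>] conjI ballI)
    show "continuous_map X euclidean \<psi>"
      unfolding \<psi>_def
      by (intro continuous_map_scaleR continuous_map_sum continuous_map_real_inverse A(1) S_cont v_cont)
        (use S_pos in \<open>auto simp: less_imp_neq[symmetric]\<close>)
    fix y assume y: "y \<in> topspace Xbar"
    define z where "z = y K"
    have z: "z \<in> topspace X"
      using coordinate_in_space[OF y] by (simp add: z_def)
    have "\<phi> y = inverse (S z) *\<^sub>R (\<Sum>x\<in>A. v x z *\<^sub>R \<phi> y)"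
      using S_pos[OF z] by (simp add: S_def scaleR_sum_left[symmetric])
    then have "\<phi> y - \<psi> z = inverse (S z) *\<^sub>R ((\<Sum>x\<in>A. v x z *\<^sub>R \<phi> y) - (\<Sum>x\<in>A. v x z *\<^sub>R \<phi> x))"
      by (simp only: \<psi>_def scaleR_diff_right)
    then have "\<phi> y - \<psi> z = inverse (S z) *\<^sub>R (\<Sum>x\<in>A. v x z *\<^sub>R (\<phi> y - \<phi> x))"
      by (simp only: scaleR_diff_right sum_subtractf)
    then have "norm (\<phi> y - \<psi> z) = inverse (S z) * norm (\<Sum>x\<in>A. v x z *\<^sub>R (\<phi> y - \<phi> x))"
      using S_pos[OF z] by simp
    also have "\<dots> \<le> inverse (S z) * (\<Sum>x\<in>A. v x z * (\<epsilon> / 2))"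
    proof (intro mult_left_mono sum_norm_le)
      fix x assume x: "x \<in> A"
      show "norm (v x z *\<^sub>R (\<phi> y - \<phi> x)) \<le> v x z * (\<epsilon> / 2)"
      proof (cases "v x z = 0")
        case False
        then have "0 < v x z"
          using v_nonneg[OF x z] by simp
        then have "norm (\<phi> y - \<phi> x) < \<epsilon> / 2"
          using u(4)[of x y] v_coord[OF x y] x A(2) y by (auto simp: z_def)
        then show ?thesis
          using \<open>0 < v x z\<close> by simp
      qed simp
    qed (use S_pos[OF z] in simp)
    also have "\<dots> = \<epsilon> / 2"
      using S_pos[OF z] by (simp add: S_def sum_divide_distrib[symmetric] sum_distrib_right[symmetric])
    finally show "norm (\<phi> y - \<psi> (y K)) < \<epsilon>"
      using \<open>0 < \<epsilon>\<close> by (simp add: z_def)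
  qed
qed

end

section \<open>Orientation preserving maps of graphs\<close>

lemma strict_mono_on_if_eq_in_interior:
  fixes h \<sigma> :: "real \<Rightarrow> real"
  assumes J: "is_interval J" and cont: "continuous_on J h" "continuous_on J \<sigma>"
    and mono: "strict_mono_on J \<sigma>"
    and eq: "\<And>u s t. s \<in> J \<Longrightarrow> t \<in> J \<Longrightarrow> s < u \<Longrightarrow> u < t \<Longrightarrow> h u = \<sigma> u"
  shows "strict_mono_on J h"
proof (rule strict_mono_onI)
  fix s t assume st: "s \<in> J" "t \<in> J" "s < t"
  have sub: "{s..t} \<subseteq> J"
    using mem_is_interval_1_I[OF J st(1,2)] by auto
  have "h u = \<sigma> u" if "u \<in> {s..t}" for u
  proof (rule continuous_map_agree_on_Icc[where X = euclideanreal, OF _ st(3) _ _ _ that])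
    show "continuous_map (top_of_set {s..t}) euclideanreal h" "continuous_map (top_of_set {s..t}) euclideanreal \<sigma>"
      using cont sub by (auto intro: continuous_on_subset)
  qed (use eq st in auto)
  then show "h s < h t"
    using strict_mono_onD[OF mono st] st(3) by simp
qed

lemma op_path_reparametrize:
  assumes op: "op_path X c S' p"
    and \<sigma>: "continuous_on S \<sigma>" "\<sigma> ` S \<subseteq> S'" "strict_mono_on S \<sigma>"
    and \<tau>: "continuous_on (\<sigma> ` S) \<tau>" "\<And>x. x \<in> S \<Longrightarrow> \<tau> (\<sigma> x) = x"
  shows "op_path X c S (\<lambda>t. p (\<sigma> t))"
  unfolding op_path_def
proof (intro conjI allI impI)
  have "continuous_map (top_of_set S) (top_of_set S') \<sigma>"
    using \<sigma>(1,2) by (auto simp: continuous_map_in_subtopology)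
  from continuous_map_compose[OF this op_path_continuous[OF op]]
  show "continuous_map (top_of_set S) X (\<lambda>t. p (\<sigma> t))"
    by (simp add: o_def)
  fix J e h assume "is_interval J \<and> J \<subseteq> S \<and> edge_lift c e J (\<lambda>t. p (\<sigma> t)) h"
  then have J: "is_interval J" "J \<subseteq> S" and h: "continuous_on J h" "h ` J \<subseteq> {0..1}" "\<And>t. t \<in> J \<Longrightarrow> p (\<sigma> t) = c e (h t)"
    by (auto simp: edge_lift_def)
  have "is_interval (\<sigma> ` J)"
    using J connected_continuous_image[OF continuous_on_subset[OF \<sigma>(1) J(2)]]
    by (simp add: is_interval_connected_1)
  moreover have "\<sigma> ` J \<subseteq> S'"
    using \<sigma>(2) J(2) by blast
  moreover have "edge_lift c e (\<sigma> ` J) p (h \<circ> \<tau>)"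
    unfolding edge_lift_def
  proof (intro conjI)
    have "\<tau> ` \<sigma> ` J = J"
      using \<tau>(2) J(2) by (force simp: image_iff)
    then show "continuous_on (\<sigma> ` J) (h \<circ> \<tau>)"
      using h(1) J(2) by (intro continuous_on_compose continuous_on_subset[OF \<tau>(1)]) auto
    show "(h \<circ> \<tau>) ` \<sigma> ` J \<subseteq> {0..1}"
      unfolding image_comp[symmetric] \<open>\<tau> ` \<sigma> ` J = J\<close> by (rule h(2))
    show "\<forall>t\<in>\<sigma> ` J. p t = c e ((h \<circ> \<tau>) t)"
      using h(3) \<tau>(2) J(2) by auto
  qed
  ultimately have mono: "strict_mono_on (\<sigma> ` J) (h \<circ> \<tau>)"
    by (rule op_pathD[OF op])
  show "strict_mono_on J h"
  proof (rule strict_mono_onI)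
    fix s t assume st: "s \<in> J" "t \<in> J" "s < t"
    then have "s \<in> S" "t \<in> S"
      using J(2) by auto
    then have "\<sigma> s < \<sigma> t"
      using strict_mono_onD[OF \<sigma>(3)] st(3) by blast
    then have "(h \<circ> \<tau>) (\<sigma> s) < (h \<circ> \<tau>) (\<sigma> t)"
      using strict_mono_onD[OF mono] st by blast
    then show "h s < h t"
      using \<tau>(2) \<open>s \<in> S\<close> \<open>t \<in> S\<close> by simp
  qed
qed

lemma (in finite_digraph) op_path_in_edge:
  assumes \<sigma>: "continuous_on S \<sigma>" "\<sigma> ` S \<subseteq> {0..1}" "strict_mono_on S \<sigma>"
  shows "op_path X c S (\<lambda>t. c e (\<sigma> t))"
  unfolding op_path_def
proof (intro conjI allI impI)
  have "continuous_map (top_of_set S) (top_of_set {0..1}) \<sigma>"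
    using \<sigma>(1,2) by (auto simp: continuous_map_in_subtopology)
  from continuous_map_compose[OF this continuous_edge]
  show "continuous_map (top_of_set S) X (\<lambda>t. c e (\<sigma> t))"
    by (simp add: o_def)
  fix J e' h assume "is_interval J \<and> J \<subseteq> S \<and> edge_lift c e' J (\<lambda>t. c e (\<sigma> t)) h"
  then have J: "is_interval J" "J \<subseteq> S" and h: "continuous_on J h" "h ` J \<subseteq> {0..1}" "\<And>t. t \<in> J \<Longrightarrow> c e (\<sigma> t) = c e' (h t)"
    by (auto simp: edge_lift_def)
  show "strict_mono_on J h"
  proof (rule strict_mono_on_if_eq_in_interior[OF J(1) h(1)])
    show "continuous_on J \<sigma>" "strict_mono_on J \<sigma>"
      using \<sigma>(1,3) J(2) by (auto intro: continuous_on_subset monotone_on_subset)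
    fix u s t assume st: "s \<in> J" "t \<in> J" "s < u" "u < t"
    then have u: "u \<in> J"
      using mem_is_interval_1_I[OF J(1) st(1,2)] by auto
    then have "\<sigma> s < \<sigma> u" "\<sigma> u < \<sigma> t"
      using strict_mono_onD[OF \<sigma>(3)] J(2) st by blast+
    moreover have "\<sigma> s \<in> {0..1}" "\<sigma> t \<in> {0..1}"
      using \<sigma>(2) J(2) st by blast+
    ultimately show "h u = \<sigma> u"
      using edge_interior_eqD(2)[OF h(3)[OF u]] h(2) u by auto
  qed
qed

locale oriented_graph_map = nondegenerate_digraph X V c + compact_surjection X f
  for X :: "'a topology" and V and c :: "'e::finite \<Rightarrow> real \<Rightarrow> 'a" and f +
  assumes Markov: "f ` V \<subseteq> V"
    and oriented: "orientation_preserving X c f"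
begin

abbreviation bonding :: "int ^ 'e \<Rightarrow> int ^ 'e"
  where "bonding v \<equiv> adjacency_matrix c f *v v"

lemma op_path_edge_image: "op_path X c {0..1} (\<lambda>t. (f ^^ n) (c e t))"
proof (induction n)
  case 0
  show ?case
    using op_path_in_edge[of "{0..1}" "\<lambda>t. t" e] by (simp add: strict_mono_on_def)
next
  case (Suc n)
  then have "op_path X c {0..1} (f \<circ> (\<lambda>t. (f ^^ n) (c e t)))"
    using oriented unfolding orientation_preserving_def by blast
  then show ?case
    by (simp add: o_def)
qed

lemma edge_path_image:
  obtains m j \<Theta> T where "edge_path X V c (\<lambda>t. f (c e t)) m j \<Theta> T"
    "\<forall>g. (bonding g) $ e = (\<Sum>i<m. g $ j i)"
proof -
  have op: "op_path X c {0..1} (\<lambda>t. f (c e t))"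
    using op_path_edge_image[of 1 e] by simp
  obtain m j \<Theta> T where E: "edge_path X V c (\<lambda>t. f (c e t)) m j \<Theta> T"
    using op_path_edge_path[OF op] Markov edge_ends by blast
  interpret edge_path X V c "\<lambda>t. f (c e t)" m j \<Theta> T
    by (rule E)
  have "\<forall>g. (bonding g) $ e = (\<Sum>i<m. g $ j i)"
  proof
    show "(bonding g) $ e = (\<Sum>i<m. g $ j i)" for g
      using sum_passages[of "\<lambda>e. g $ e"] by (simp add: matrix_vector_mult_def adjacency_matrix_def)
  qed
  with E show ?thesis
    by (rule that)
qed

lemma winding_map_pullback:
  obtains H where "continuous_map X euclideanreal H"
    "\<And>x. x \<in> topspace X \<Longrightarrow> winding_map c g (f x) = winding_map c (bonding g) x * cis (2 * pi * H x)"
proof -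
  have "\<exists>\<theta>. continuous_on {0..1} \<theta> \<and> (\<forall>t\<in>{0..1}. winding_map c g (f (c e t)) = cis (2 * pi * \<theta> t)) \<and>
      \<theta> 0 = 0 \<and> \<theta> 1 = of_int ((bonding g) $ e)" for e
  proof -
    obtain m j \<Theta> T where E: "edge_path X V c (\<lambda>t. f (c e t)) m j \<Theta> T"
      and sum: "\<forall>g. (bonding g) $ e = (\<Sum>i<m. g $ j i)"
      by (rule edge_path_image[of e])
    interpret edge_path X V c "\<lambda>t. f (c e t)" m j \<Theta> T
      by (rule E)
    obtain \<theta> where \<theta>: "continuous_on {0..1} \<theta>"
      "\<And>t. t \<in> {0..1} \<Longrightarrow> winding_map c g (f (c e t)) = cis (2 * pi * \<theta> t)"
      using angle_of_path[OF continuous_p convex_real_interval(5)] by blast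
    have "\<theta> 0 \<in> \<int>"
      using \<theta>(2)[of 0] Markov edge_ends(1)[of e] by (simp add: image_subset_iff flip: cis_2pi_eq_1_iff)
    then have "\<forall>t\<in>{0..1}. winding_map c g (f (c e t)) = cis (2 * pi * (\<theta> t - \<theta> 0))"
      by (simp add: \<theta>(2) cis_2pi_eq_iff)
    moreover have "\<theta> 1 - \<theta> 0 = of_int ((bonding g) $ e)"
      using total_angle[OF \<theta>] sum by simp
    moreover have "continuous_on {0..1} (\<lambda>t. \<theta> t - \<theta> 0)"
      by (intro continuous_intros \<theta>(1))
    ultimately show ?thesis
      by (intro exI[of _ "\<lambda>t. \<theta> t - \<theta> 0"]) simp
  qed
  then obtain \<theta> where "\<forall>e. continuous_on {0..1} (\<theta> e) \<and>
      (\<forall>t\<in>{0..1}. winding_map c g (f (c e t)) = cis (2 * pi * \<theta> e t)) \<and>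
      \<theta> e 0 = 0 \<and> \<theta> e 1 = of_int ((bonding g) $ e)"
    using choice[of "\<lambda>e \<theta>. continuous_on {0..1} \<theta> \<and>
      (\<forall>t\<in>{0..1}. winding_map c g (f (c e t)) = cis (2 * pi * \<theta> t)) \<and>
      \<theta> 0 = 0 \<and> \<theta> 1 = of_int ((bonding g) $ e)"] by blast
  then have \<theta>: "\<And>e. continuous_on {0..1} (\<theta> e)"
    "\<And>e t. t \<in> {0..1} \<Longrightarrow> winding_map c g (f (c e t)) = cis (2 * pi * \<theta> e t)"
    "\<And>e. \<theta> e 0 = 0" "\<And>e. \<theta> e 1 = of_int ((bonding g) $ e)"
    by blast+
  obtain H where H: "continuous_map X euclideanreal H"
    "\<And>e t. t \<in> {0..1} \<Longrightarrow> H (c e t) = \<theta> e t - t * of_int ((bonding g) $ e)"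
    by (rule real_function_on_graph[of "\<lambda>e t. \<theta> e t - t * of_int ((bonding g) $ e)" "\<lambda>_. 0"])
      (auto simp: \<theta>(3,4) intro!: continuous_intros \<theta>(1))
  show ?thesis
  proof (rule that[OF H(1)])
    fix x assume "x \<in> topspace X"
    then obtain e t where t: "0 \<le> t" "t \<le> 1" "x = c e t"
      by (rule edge_preimage)
    then have "\<theta> e t = t * of_int ((bonding g) $ e) + H x"
      using H(2)[of t e] by simp
    then show "winding_map c g (f x) = winding_map c (bonding g) x * cis (2 * pi * H x)"
      using t \<theta>(2)[of t e] winding_map_edge[of t "bonding g" e] by (simp add: cis_mult distrib_left)
  qed
qed

lemma inverse_branch:
  "\<exists>e' \<sigma>. continuous_on {0..1} \<sigma> \<and> strict_mono_on {0..1} \<sigma> \<and> \<sigma> ` {0..1} \<subseteq> {0..1} \<and>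
    (\<forall>s\<in>{0..1}. f (c e' (\<sigma> s)) = c e s)"
proof -
  have "c e (1/2) \<in> topspace X"
    by (rule edge_in_space) simp
  then obtain y where y: "y \<in> topspace X" "f y = c e (1/2)"
    using surj_f by (metis imageE)
  then obtain e' t where t: "0 \<le> t" "t \<le> 1" "y = c e' t"
    using edge_preimage by blast
  obtain m j \<Theta> T where E: "edge_path X V c (\<lambda>t. f (c e' t)) m j \<Theta> T"
    by (rule edge_path_image[of e'])
  interpret edge_path X V c "\<lambda>t. f (c e' t)" m j \<Theta> T
    by (rule E)
  have "\<Theta> t \<notin> \<int>"
    using interior_angle_not_Ints[of t] t y edge_interior_not_V[of "1/2" e] by simp
  moreover have \<Theta>t: "0 \<le> \<Theta> t" "\<Theta> t \<le> real m"
    using \<Theta>_image[of t] t by auto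
  moreover define i where "i = nat \<lfloor>\<Theta> t\<rfloor>"
  ultimately have i: "real i < \<Theta> t" "\<Theta> t < real i + 1"
    using frac_gt_0_iff[of "\<Theta> t"] by (simp_all add: frac_def)
  then have "i < m"
    using \<Theta>t by linarith
  have "c e (1/2) = c (j i) (\<Theta> t - real i)"
    using p_edge[OF \<open>i < m\<close>, of t] t y i by simp
  then have "j i = e"
    using edge_interior_eqD(1)[of e "1/2" "j i" "\<Theta> t - real i"] i by simp
  have in_dom: "real i + s \<in> {0..real m}" if "s \<in> {0..1}" for s
    using that \<open>i < m\<close> by auto
  have "continuous_on {0..1} (\<lambda>s. T (real i + s))"
  proof (rule continuous_on_compose2[OF continuous_T])
    show "(\<lambda>s. real i + s) ` {0..1} \<subseteq> {0..real m}"
      using in_dom by blast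
  qed (intro continuous_intros)
  moreover have "strict_mono_on {0..1} (\<lambda>s. T (real i + s))"
  proof (rule strict_mono_onI)
    fix s t :: real assume "s \<in> {0..1}" "t \<in> {0..1}" "s < t"
    then show "T (real i + s) < T (real i + t)"
      using T_less[OF _ in_dom in_dom] by simp
  qed
  moreover have "(\<lambda>s. T (real i + s)) ` {0..1} \<subseteq> {0..1}"
    using T_image in_dom by blast
  moreover have "\<forall>s\<in>{0..1}. f (c e' (T (real i + s))) = c e s"
    using p_T[OF \<open>i < m\<close>] \<open>j i = e\<close> by simp
  ultimately show ?thesis by blast
qed

end

section \<open>The map from the direct limit\<close>

lemma nearby_circle_maps:
  assumes \<phi>: "circle_map Y \<phi>" and \<psi>: "circle_map Y \<psi>"
    and near: "\<And>y. y \<in> topspace Y \<Longrightarrow> 0 < Re (\<phi> y * cnj (\<psi> y))"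
  shows "\<exists>g. continuous_map Y euclideanreal g \<and> (\<forall>y\<in>topspace Y. \<phi> y = \<psi> y * cis (2 * pi * g y))"
proof -
  define r where "r y = \<phi> y * cnj (\<psi> y)" for y
  have r: "circle_map Y r"
    unfolding r_def by (intro circle_map_mult circle_map_cnj \<phi> \<psi>)
  have Arg: "continuous_on {z. 0 < Re z} (\<lambda>z. Arg z / (2 * pi))"
    by (intro continuous_intros) (auto simp: complex_nonpos_Reals_iff)
  have "r ` topspace Y \<subseteq> {z. 0 < Re z}"
    using near by (simp add: r_def image_subset_iff)
  moreover have "continuous_map Y euclidean r"
    using r by (simp add: circle_map_iff)
  ultimately have cont: "continuous_map Y euclideanreal (\<lambda>y. Arg (r y) / (2 * pi))"
    using Arg by (intro continuous_map_compose_continuous_on[of Y r _ "\<lambda>z. Arg z / (2 * pi)"])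
  show ?thesis
  proof (intro exI conjI ballI, rule cont)
    fix y assume y: "y \<in> topspace Y"
    have "r y \<noteq> 0" "norm (r y) = 1"
      using near[OF y] r y by (auto simp: r_def circle_map_iff)
    then have "cis (2 * pi * (Arg (r y) / (2 * pi))) = r y"
      by (simp add: cis_Arg sgn_eq)
    moreover have "\<psi> y * cnj (\<psi> y) = 1"
      using \<psi> y complex_norm_square[of "\<psi> y"] by (simp add: circle_map_iff)
    ultimately show "\<phi> y = \<psi> y * cis (2 * pi * (Arg (r y) / (2 * pi)))"
      by (simp add: r_def mult_ac)
  qed
qed

lemma (in nondegenerate_digraph) circle_map_on_graph:
  assumes \<psi>: "circle_map X \<psi>"
  shows "\<exists>g H. continuous_map X euclideanreal H \<and>
    (\<forall>x\<in>topspace X. \<psi> x = winding_map c g x * cis (2 * pi * H x))"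
proof -
  define a where "a x = Arg (\<psi> x) / (2 * pi)" for x
  have a: "\<psi> x = cis (2 * pi * a x)" if "x \<in> topspace X" for x
  proof -
    have "norm (\<psi> x) = 1"
      using \<psi> that by (simp add: circle_map_iff)
    moreover from this have "\<psi> x \<noteq> 0" by auto
    ultimately show ?thesis
      by (simp add: a_def cis_Arg sgn_eq)
  qed
  define good where "good e \<theta> \<longleftrightarrow> continuous_on {0..1} \<theta> \<and>
    (\<forall>t\<in>{0..1}. \<psi> (c e t) = cis (2 * pi * \<theta> t)) \<and> \<theta> 0 = a (c e 0)" for e and \<theta> :: "real \<Rightarrow> real"
  have "\<exists>\<theta>. good e \<theta>" for e
  proof -
    have "continuous_map (top_of_set {0..1}) euclidean (\<lambda>t. \<psi> (c e t))"
      using continuous_map_compose[OF continuous_edge] \<psi> by (fastforce simp: circle_map_iff o_def)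
    moreover have "norm (\<psi> (c e t)) = 1" if "t \<in> {0..1}" for t
      using \<psi> edge_in_space[OF that] by (simp add: circle_map_iff)
    ultimately obtain \<theta> where \<theta>: "continuous_on {0..1} \<theta>" "\<And>t. t \<in> {0..1} \<Longrightarrow> \<psi> (c e t) = cis (2 * pi * \<theta> t)"
      using exists_continuous_angle[OF convex_real_interval(5), of 0 1 "\<lambda>t. \<psi> (c e t)"] by auto
    have "cis (2 * pi * \<theta> 0) = cis (2 * pi * a (c e 0))"
      using \<theta>(2)[of 0] a[OF edge_in_space[of 0 e]] by simp
    then have 0: "a (c e 0) - \<theta> 0 \<in> \<int>"
      by (metis cis_2pi_eq_iff)
    have "\<psi> (c e t) = cis (2 * pi * (\<theta> t + (a (c e 0) - \<theta> 0)))" if "t \<in> {0..1}" for t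
      unfolding \<theta>(2)[OF that] cis_2pi_eq_iff using Ints_minus[OF 0] by simp
    moreover have "continuous_on {0..1} (\<lambda>t. \<theta> t + (a (c e 0) - \<theta> 0))"
      by (intro continuous_intros \<theta>(1))
    ultimately show ?thesis
      unfolding good_def by (intro exI[of _ "\<lambda>t. \<theta> t + (a (c e 0) - \<theta> 0)"]) simp
  qed
  then obtain \<theta> where "\<And>e. good e (\<theta> e)"
    by metis
  then have \<theta>: "\<And>e. continuous_on {0..1} (\<theta> e)" "\<And>e t. t \<in> {0..1} \<Longrightarrow> \<psi> (c e t) = cis (2 * pi * \<theta> e t)"
    "\<And>e. \<theta> e 0 = a (c e 0)"
    unfolding good_def by blast+
  have "cis (2 * pi * \<theta> e 1) = cis (2 * pi * a (c e 1))" for e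
    using \<theta>(2)[of 1 e] a[OF edge_in_space[of 1 e]] by simp
  then have "\<theta> e 1 - a (c e 1) \<in> \<int>" for e
    by (simp add: cis_2pi_eq_iff)
  then have "\<exists>n. \<theta> e 1 - a (c e 1) = of_int n" for e
    by (metis Ints_cases)
  then obtain n where n: "\<And>e. \<theta> e 1 - a (c e 1) = of_int (n e)"
    by metis
  define g :: "int ^ 'b" where "g = (\<chi> e. n e)"
  have "continuous_on {0..1} (\<lambda>t. \<theta> e t - t * of_int (n e))" for e
    by (intro continuous_intros \<theta>(1))
  moreover have "\<theta> e 0 - 0 * of_int (n e) = a (c e 0)" "\<theta> e 1 - 1 * of_int (n e) = a (c e 1)" for e
    using \<theta>(3)[of e] n[of e] by simp_all
  ultimately obtain H where H: "continuous_map X euclideanreal H"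
    "\<And>e t. t \<in> {0..1} \<Longrightarrow> H (c e t) = \<theta> e t - t * of_int (n e)"
    using real_function_on_graph[of "\<lambda>e t. \<theta> e t - t * of_int (n e)" a] by blast
  show ?thesis
  proof (intro exI conjI ballI, rule H(1))
    fix x assume "x \<in> topspace X"
    then obtain e t where t: "0 \<le> t" "t \<le> 1" "x = c e t"
      by (rule edge_preimage)
    then have "\<theta> e t = t * of_int (n e) + H x"
      using H(2)[of t e] by simp
    then show "\<psi> x = winding_map c g x * cis (2 * pi * H x)"
      using t \<theta>(2)[of t e] winding_map_edge[of t g e] by (simp add: g_def cis_mult distrib_left)
  qed
qed

context oriented_graph_map
begin

lemma winding_map_pullback_funpow:
  "\<exists>H. continuous_map X euclideanreal H \<and>
    (\<forall>x\<in>topspace X. winding_map c g ((f ^^ n) x) = winding_map c ((bonding ^^ n) g) x * cis (2 * pi * H x))"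
proof (induction n)
  case 0
  show ?case
    by (rule exI[of _ "\<lambda>_. 0"]) simp
next
  case (Suc n)
  then obtain H where H: "continuous_map X euclideanreal H"
    "\<And>x. x \<in> topspace X \<Longrightarrow> winding_map c g ((f ^^ n) x) = winding_map c ((bonding ^^ n) g) x * cis (2 * pi * H x)"
    by blast
  obtain H' where H': "continuous_map X euclideanreal H'"
    "\<And>x. x \<in> topspace X \<Longrightarrow> winding_map c ((bonding ^^ n) g) (f x) =
      winding_map c (bonding ((bonding ^^ n) g)) x * cis (2 * pi * H' x)"
    using winding_map_pullback by blast
  have "continuous_map X euclideanreal (\<lambda>x. H (f x))"
    using continuous_map_compose[OF continuous_f H(1)] by (simp add: o_def)
  then have "continuous_map X euclideanreal (\<lambda>x. H' x + H (f x))"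
    by (intro continuous_map_add H'(1))
  moreover have "winding_map c g ((f ^^ Suc n) x) =
      winding_map c ((bonding ^^ Suc n) g) x * cis (2 * pi * (H' x + H (f x)))" if "x \<in> topspace X" for x
    using H(2)[OF f_in_space[OF that]] H'(2)[OF that] by (simp add: funpow_swap1 cis_mult distrib_left)
  ultimately show ?case
    by blast
qed

lemma circle_map_winding_coordinate: "circle_map Xbar (\<lambda>x. winding_map c g (x k))"
  using continuous_map_compose[OF continuous_coordinate[of k] continuous_winding_map[of g]] unfolding o_def .

lemma Br_class_funpow_bonding:
  "Br_class Xbar (\<lambda>x. winding_map c g (x k)) = Br_class Xbar (\<lambda>x. winding_map c ((bonding ^^ n) g) (x (k + n)))"
proof -
  obtain H where H: "continuous_map X euclideanreal H"
    "\<And>x. x \<in> topspace X \<Longrightarrow> winding_map c g ((f ^^ n) x) = winding_map c ((bonding ^^ n) g) x * cis (2 * pi * H x)"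
    using winding_map_pullback_funpow[of g n] by blast
  have "continuous_map Xbar euclideanreal (\<lambda>x. H (x (k + n)))"
    using continuous_map_compose[OF continuous_coordinate H(1)] by (simp add: o_def)
  moreover have "\<forall>x\<in>topspace Xbar. winding_map c g (x k) =
      winding_map c ((bonding ^^ n) g) (x (k + n)) * cis (2 * pi * H (x (k + n)))"
  proof
    fix x assume x: "x \<in> topspace Xbar"
    show "winding_map c g (x k) = winding_map c ((bonding ^^ n) g) (x (k + n)) * cis (2 * pi * H (x (k + n)))"
      using H(2)[OF coordinate_in_space[OF x, of "k + n"]] unfolding coordinate_funpow[OF x] .
  qed
  ultimately show ?thesis
    unfolding Br_class_eq_iff[OF circle_map_winding_coordinate circle_map_winding_coordinate]
    by (intro exI[of _ "\<lambda>x. H (x (k + n))"] conjI)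
qed

lemma iota_limit_class:
  "iota Xbar c (limit_class (adjacency_matrix c f) k g) = Br_class Xbar (\<lambda>x. winding_map c g (x k))"
proof -
  have "Br_class Xbar (\<lambda>x. winding_map c h (x l)) = Br_class Xbar (\<lambda>x. winding_map c g (x k))"
    if lh: "(l, h) \<in> limit_class (adjacency_matrix c f) k g" for l h
  proof -
    obtain N where N: "(bonding ^^ (k + N)) h = (bonding ^^ (l + N)) g"
      using lh unfolding limit_class_mem limit_class_eq_iff limit_rel_iff by blast
    have "Br_class Xbar (\<lambda>x. winding_map c h (x l)) =
        Br_class Xbar (\<lambda>x. winding_map c ((bonding ^^ (k + N)) h) (x (l + (k + N))))"
      by (rule Br_class_funpow_bonding)
    also have "\<dots> = Br_class Xbar (\<lambda>x. winding_map c ((bonding ^^ (l + N)) g) (x (k + (l + N))))"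
      unfolding N by (simp only: add.left_commute)
    also have "\<dots> = Br_class Xbar (\<lambda>x. winding_map c g (x k))"
      by (rule Br_class_funpow_bonding[symmetric])
    finally show ?thesis .
  qed
  then have "(\<lambda>(k, g). Br_class Xbar (\<lambda>x. winding_map c g (x k))) p = Br_class Xbar (\<lambda>x. winding_map c g (x k))"
    if "p \<in> limit_class (adjacency_matrix c f) k g" for p
    using that by (cases p) (simp only: prod.case)
  moreover have "limit_class (adjacency_matrix c f) k g \<noteq> {}"
    using limit_class_self by blast
  ultimately show ?thesis
    unfolding iota_def by (metis (no_types, lifting) image_cong image_constant_conv the_elem_eq)
qed

lemma iota_hom: "iota Xbar c \<in> hom (limit_group (adjacency_matrix c f)) (Br Xbar)"
proof (rule homI)
  fix A assume "A \<in> carrier (limit_group (adjacency_matrix c f))"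
  then obtain k g where A: "A = limit_class (adjacency_matrix c f) k g"
    by (rule carrier_limit_groupE)
  show "iota Xbar c A \<in> carrier (Br Xbar)"
    unfolding A iota_limit_class by (rule Br_class_in_carrier[OF circle_map_winding_coordinate])
  fix B assume "B \<in> carrier (limit_group (adjacency_matrix c f))"
  then obtain l h where B: "B = limit_class (adjacency_matrix c f) l h"
    by (rule carrier_limit_groupE)
  have "Br_class Xbar (\<lambda>x. winding_map c g (x k)) \<otimes>\<^bsub>Br Xbar\<^esub> Br_class Xbar (\<lambda>x. winding_map c h (x l)) =
      Br_class Xbar (\<lambda>x. winding_map c ((bonding ^^ l) g) (x (k + l)) * winding_map c ((bonding ^^ k) h) (x (k + l)))"
    using Br_class_funpow_bonding[of g k l] Br_class_funpow_bonding[of h l k]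
    by (simp add: add.commute[of l k] Br_class_mult circle_map_winding_coordinate)
  also have "\<dots> = Br_class Xbar (\<lambda>x. winding_map c ((bonding ^^ l) g + (bonding ^^ k) h) (x (k + l)))"
    unfolding Br_class_def
    by (rule arg_cong[where f = "\<lambda>\<phi>. _ #>\<^bsub>_\<^esub> \<phi>"], rule restrict_ext)
      (simp add: winding_map_add coordinate_in_space)
  finally show "iota Xbar c (A \<otimes>\<^bsub>limit_group (adjacency_matrix c f)\<^esub> B) = iota Xbar c A \<otimes>\<^bsub>Br Xbar\<^esub> iota Xbar c B"
    unfolding A B limit_class_mult iota_limit_class by simp
qed

lemma Br_class_from_coordinate:
  assumes \<phi>: "circle_map Xbar \<phi>"
  obtains k g where "Br_class Xbar \<phi> = Br_class Xbar (\<lambda>x. winding_map c g (x k))"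
proof -
  have \<phi>_cont: "continuous_map Xbar euclidean \<phi>"
    using \<phi> by (simp add: circle_map_iff)
  obtain k \<psi> where \<psi>: "continuous_map X euclidean \<psi>"
    "\<And>x. x \<in> topspace Xbar \<Longrightarrow> norm (\<phi> x - \<psi> (x k)) < 1"
    using approximation_by_coordinate[OF \<phi>_cont zero_less_one] by blast
  have Re_pos: "0 < Re (\<phi> x * cnj (\<psi> (x k)))" if x: "x \<in> topspace Xbar" for x
  proof -
    have "norm (\<phi> x) = 1"
      using \<phi> x by (simp add: circle_map_iff)
    then have "\<phi> x * cnj (\<psi> (x k)) = 1 - \<phi> x * cnj (\<phi> x - \<psi> (x k))"
      using complex_norm_square[of "\<phi> x"] by (simp add: algebra_simps)
    moreover have "Re (\<phi> x * cnj (\<phi> x - \<psi> (x k))) < 1"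
      using complex_Re_le_cmod[of "\<phi> x * cnj (\<phi> x - \<psi> (x k))"] \<psi>(2)[OF x] \<open>norm (\<phi> x) = 1\<close>
      by (simp add: norm_mult del: complex_cnj_diff)
    ultimately show ?thesis by simp
  qed
  have \<psi>_nz: "\<psi> z \<noteq> 0" if z: "z \<in> topspace X" for z
  proof -
    obtain x where "x \<in> topspace Xbar" "x k = z"
      using surj_coordinate[OF z] .
    then show ?thesis
      using Re_pos by force
  qed
  have sgn_\<psi>: "circle_map X (\<lambda>z. sgn (\<psi> z))"
  proof -
    have "continuous_on (- {0}) (sgn :: complex \<Rightarrow> complex)"
      by (intro continuous_on_sgn continuous_on_id) auto
    moreover have "\<psi> ` topspace X \<subseteq> - {0}"
      by (intro image_subsetI) (simp add: \<psi>_nz)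
    ultimately have "continuous_map X euclidean (\<lambda>z. sgn (\<psi> z))"
      by (intro continuous_map_compose_continuous_on[OF \<psi>(1), of "- {0}"])
    then show ?thesis
      using \<psi>_nz by (simp add: circle_map_iff norm_sgn)
  qed
  obtain g H where H: "continuous_map X euclideanreal H"
    "\<And>z. z \<in> topspace X \<Longrightarrow> sgn (\<psi> z) = winding_map c g z * cis (2 * pi * H z)"
    using circle_map_on_graph[OF sgn_\<psi>] by blast
  have sgn_coord: "circle_map Xbar (\<lambda>x. sgn (\<psi> (x k)))"
    using continuous_map_compose[OF continuous_coordinate sgn_\<psi>] by (simp add: o_def)
  have "Br_class Xbar \<phi> = Br_class Xbar (\<lambda>x. sgn (\<psi> (x k)))"
  proof -
    have "0 < Re (\<phi> x * cnj (sgn (\<psi> (x k))))" if x: "x \<in> topspace Xbar" for x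
    proof -
      have "\<phi> x * cnj (sgn (\<psi> (x k))) = inverse (norm (\<psi> (x k))) *\<^sub>R (\<phi> x * cnj (\<psi> (x k)))"
        by (simp add: sgn_div_norm)
      then show ?thesis
        using Re_pos[OF x] \<psi>_nz[OF coordinate_in_space[OF x]] by simp
    qed
    then show ?thesis
      unfolding Br_class_eq_iff[OF \<phi> sgn_coord] by (rule nearby_circle_maps[OF \<phi> sgn_coord])
  qed
  also have "\<dots> = Br_class Xbar (\<lambda>x. winding_map c g (x k))"
  proof -
    have "continuous_map Xbar euclideanreal (\<lambda>x. H (x k))"
      using continuous_map_compose[OF continuous_coordinate H(1)] by (simp add: o_def)
    then show ?thesis
      unfolding Br_class_eq_iff[OF sgn_coord circle_map_winding_coordinate]
      using H(2) coordinate_in_space by (intro exI[of _ "\<lambda>x. H (x k)"]) simp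
  qed
  finally show ?thesis
    by (rule that)
qed

lemma iota_epi: "iota Xbar c \<in> epi (limit_group (adjacency_matrix c f)) (Br Xbar)"
proof -
  have "A \<in> iota Xbar c ` carrier (limit_group (adjacency_matrix c f))" if A: "A \<in> carrier (Br Xbar)" for A
  proof -
    obtain \<phi> where \<phi>: "circle_map Xbar \<phi>" "A = Br_class Xbar \<phi>"
      using A by (rule carrier_BrE)
    obtain k g where "Br_class Xbar \<phi> = Br_class Xbar (\<lambda>x. winding_map c g (x k))"
      using \<phi>(1) by (rule Br_class_from_coordinate)
    then have "A = iota Xbar c (limit_class (adjacency_matrix c f) k g)"
      by (simp only: iota_limit_class \<phi>(2))
    then show ?thesis
      using limit_class_in_carrier by (rule image_eqI)
  qed
  then show ?thesis
    using iota_hom hom_carrier[OF iota_hom] by (auto simp: epi_def)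
qed

lemma iota_group_hom: "group_hom (limit_group (adjacency_matrix c f)) (Br Xbar) (iota Xbar c)"
  unfolding group_hom_def group_hom_axioms_def
  using comm_group_limit_group[of "adjacency_matrix c f"] comm_group_Br[of Xbar] iota_hom
  by (simp add: comm_group_def)

lemma iota_cone: "iota Xbar c ` limit_cone (adjacency_matrix c f) \<subseteq> Br_cone Xbar X c"
proof
  fix A assume "A \<in> iota Xbar c ` limit_cone (adjacency_matrix c f)"
  then obtain k g where g: "\<And>e. 0 \<le> g $ e" and "A = iota Xbar c (limit_class (adjacency_matrix c f) k g)"
    by (auto simp: limit_cone_def)
  then have A: "A = Br_class Xbar (\<lambda>x. winding_map c g (x k))"
    by (simp add: iota_limit_class)
  define \<phi> where "\<phi> = restrict (\<lambda>x. winding_map c g (x k)) (topspace Xbar)"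
  have "A = Br_class Xbar \<phi>"
    by (simp add: A \<phi>_def Br_class_def)
  moreover have "\<phi> \<in> carrier (circle_maps Xbar)"
    unfolding \<phi>_def by (rule restrict_in_circle_maps[OF circle_map_winding_coordinate])
  moreover have "(\<lambda>x\<in>topspace Xbar. 1) \<in> exp_maps Xbar"
    using subgroup.one_closed[OF subgroup_exp_maps] by (simp add: one_circle_maps)
  moreover have "never_clockwise (\<lambda>t. (\<phi> \<otimes>\<^bsub>circle_maps Xbar\<^esub> (\<lambda>x\<in>topspace Xbar. 1)) (\<gamma> t))"
    if \<gamma>: "op_curve Xbar X c \<gamma>" for \<gamma>
  proof -
    have "\<gamma> t \<in> topspace Xbar" for t
      using \<gamma> continuous_map_image_subset_topspace[of euclideanreal Xbar \<gamma>] by (auto simp: op_curve_def)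
    then have "(\<phi> \<otimes>\<^bsub>circle_maps Xbar\<^esub> (\<lambda>x\<in>topspace Xbar. 1)) (\<gamma> t) = winding_map c g (\<gamma> t k)" for t
      by (simp add: mult_circle_maps \<phi>_def)
    moreover have "never_clockwise (\<lambda>t. winding_map c g (\<gamma> t k))"
      using \<gamma> g by (intro never_clockwise_winding_map) (auto simp: op_curve_def)
    ultimately show ?thesis by simp
  qed
  ultimately show "A \<in> Br_cone Xbar X c"
    unfolding Br_cone_def by blast
qed

end

section \<open>Elementary presentations\<close>

context oriented_graph_map
begin

text \<open>The edge is lifted to later coordinates by inverse branches of \<open>f\<close>.\<close>
lemma curve_through_edge:
  "\<exists>\<Gamma>. continuous_map (top_of_set {0..1}) Xbar \<Gamma> \<and> (\<forall>n. op_path X c {0..1} (\<lambda>t. \<Gamma> t n)) \<and>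
    (\<forall>t\<in>{0..1}. \<Gamma> t K = c e t)"
proof -
  define branch where "branch e e' \<sigma> \<longleftrightarrow> continuous_on {0..1} \<sigma> \<and> strict_mono_on {0..1} \<sigma> \<and>
    \<sigma> ` {0..1} \<subseteq> {0..1} \<and> (\<forall>s\<in>{0..1}. f (c e' (\<sigma> s)) = c e s)" for e e' and \<sigma> :: "real \<Rightarrow> real"
  have "\<exists>p. branch e (fst p) (snd p)" for e
    using inverse_branch[of e] unfolding branch_def by (metis fst_conv snd_conv)
  then obtain p where p: "\<And>e. branch e (fst (p e)) (snd (p e))"
    by metis
  define P \<sigma> where "P e = fst (p e)" and "\<sigma> e = snd (p e)" for e
  have \<sigma>: "continuous_on {0..1} (\<sigma> e)" "strict_mono_on {0..1} (\<sigma> e)" "\<sigma> e ` {0..1} \<subseteq> {0..1}"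
    "\<And>s. s \<in> {0..1} \<Longrightarrow> f (c (P e) (\<sigma> e s)) = c e s" for e
    using p[of e] unfolding branch_def P_def \<sigma>_def by blast+
  define E where "E n = (P ^^ n) e" for n
  define s where "s = rec_nat (\<lambda>t. t) (\<lambda>n sn t. \<sigma> (E n) (sn t))"
  have s_0: "s 0 t = t" and s_Suc: "s (Suc n) t = \<sigma> (E n) (s n t)" for n t
    by (simp_all add: s_def)
  have s: "continuous_on {0..1} (s n) \<and> strict_mono_on {0..1} (s n) \<and> s n ` {0..1} \<subseteq> {0..1}" for n
  proof (induction n)
    case 0
    have "s 0 = (\<lambda>t. t)"
      by (rule ext) (rule s_0)
    then show ?case
      by (simp add: strict_mono_on_def)
  next
    case (Suc n)
    have "s (Suc n) = (\<lambda>t. \<sigma> (E n) (s n t))"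
      by (rule ext) (rule s_Suc)
    moreover have "continuous_on {0..1} (\<lambda>t. \<sigma> (E n) (s n t))"
      using Suc by (intro continuous_on_compose2[OF \<sigma>(1)]) auto
    moreover have "strict_mono_on {0..1} (\<lambda>t. \<sigma> (E n) (s n t))"
    proof (rule strict_mono_onI)
      fix x y :: real assume xy: "x \<in> {0..1}" "y \<in> {0..1}" "x < y"
      then have "s n x < s n y"
        using Suc strict_mono_onD by blast
      moreover have "s n x \<in> {0..1}" "s n y \<in> {0..1}"
        using Suc xy by blast+
      ultimately show "\<sigma> (E n) (s n x) < \<sigma> (E n) (s n y)"
        using strict_mono_onD[OF \<sigma>(2)] by blast
    qed
    moreover have "(\<lambda>t. \<sigma> (E n) (s n t)) ` {0..1} \<subseteq> {0..1}"
      using Suc \<sigma>(3)[of "E n"] by blast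
    ultimately show ?case by simp
  qed
  have s_in: "s n t \<in> {0..1}" if "t \<in> {0..1}" for n t
    using s that by blast
  define \<Gamma> where "\<Gamma> t n = (if n < K then (f ^^ (K - n)) (c e t) else c (E (n - K)) (s (n - K) t))" for t n
  have op: "op_path X c {0..1} (\<lambda>t. \<Gamma> t n)" for n
  proof (cases "n < K")
    case True
    then show ?thesis
      using op_path_edge_image by (simp add: \<Gamma>_def)
  next
    case False
    then show ?thesis
      using op_path_in_edge s by (simp add: \<Gamma>_def)
  qed
  have \<Gamma>_K: "\<Gamma> t K = c e t" for t
    by (simp add: \<Gamma>_def E_def s_0)
  have "f (\<Gamma> t (Suc n)) = \<Gamma> t n" if t: "t \<in> {0..1}" for t n
  proof (cases "n < K")
    case True
    show ?thesis
    proof (cases "Suc n = K")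
      case True
      then have "K - n = Suc 0"
        by simp
      then have "\<Gamma> t n = f (c e t)"
        using \<open>n < K\<close> by (simp add: \<Gamma>_def)
      then show ?thesis
        using \<Gamma>_K True by simp
    next
      case False
      then have "Suc n < K" "K - n = Suc (K - Suc n)"
        using \<open>n < K\<close> by auto
      then show ?thesis
        using \<open>n < K\<close> by (simp add: \<Gamma>_def)
    qed
  next
    case False
    then have "Suc n - K = Suc (n - K)" by simp
    then have "\<Gamma> t (Suc n) = c (P (E (n - K))) (\<sigma> (E (n - K)) (s (n - K) t))"
      using False by (simp add: \<Gamma>_def s_Suc E_def)
    then show ?thesis
      using False \<sigma>(4)[OF s_in[OF t]] by (simp add: \<Gamma>_def)
  qed
  then have "continuous_map (top_of_set {0..1}) Xbar \<Gamma>"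
    using op_path_continuous[OF op] by (intro continuous_map_into_Xbar) auto
  then show ?thesis
    using op \<Gamma>_K by blast
qed

lemma op_curve_through_edge:
  assumes \<Gamma>: "continuous_map (top_of_set {0..1}) Xbar \<Gamma>" "\<And>n. op_path X c {0..1} (\<lambda>t. \<Gamma> t n)"
      "\<And>t. t \<in> {0..1} \<Longrightarrow> \<Gamma> t K = c e t"
    and \<sigma>: "continuous_on UNIV \<sigma>" "strict_mono \<sigma>" "range \<sigma> = {0<..<1}"
    and \<tau>: "continuous_on {0<..<1} \<tau>" "\<And>t. \<tau> (\<sigma> t) = t"
  shows "op_curve Xbar X c (\<lambda>t. \<Gamma> (\<sigma> t))"
  unfolding op_curve_def
proof (intro conjI allI)
  have \<sigma>_in: "\<sigma> t \<in> {0<..<1}" for t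
    using \<sigma>(3) by blast
  then have \<sigma>_in': "\<sigma> t \<in> {0..1}" for t
    by (meson greaterThanLessThan_subseteq_atLeastAtMost_iff order_refl subsetD)
  have "continuous_map euclideanreal (top_of_set {0..1}) \<sigma>"
    using \<sigma>(1) \<sigma>_in' by (simp add: continuous_map_in_subtopology)
  from continuous_map_compose[OF this \<Gamma>(1)]
  show "continuous_map euclideanreal Xbar (\<lambda>t. \<Gamma> (\<sigma> t))"
    by (simp add: o_def)
  show "locally_one_to_one euclideanreal (\<lambda>t. \<Gamma> (\<sigma> t))"
  proof -
    have "inj (\<lambda>t. \<Gamma> (\<sigma> t))"
    proof (rule injI)
      fix s t assume "\<Gamma> (\<sigma> s) = \<Gamma> (\<sigma> t)"
      then have "c e (\<sigma> s) = c e (\<sigma> t)"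
        using \<Gamma>(3)[OF \<sigma>_in'] by metis
      then have "\<sigma> s = \<sigma> t"
        using inj_onD[OF inj_edge _ \<sigma>_in \<sigma>_in] by blast
      then show "s = t"
        using \<tau>(2) by metis
    qed
    then show ?thesis
      unfolding locally_one_to_one_def by (auto intro: exI[of _ UNIV])
  qed
  show "op_path X c UNIV (\<lambda>t. \<Gamma> (\<sigma> t) k)" for k
    by (rule op_path_reparametrize[OF \<Gamma>(2) \<sigma>(1) _ \<sigma>(2)]) (use \<sigma>_in' \<sigma>(3) \<tau> in auto)
qed

end

lemma open_unit_interval_parametrization:
  obtains \<sigma> \<tau> :: "real \<Rightarrow> real"
  where "continuous_on UNIV \<sigma>" "strict_mono \<sigma>" "range \<sigma> = {0<..<1}" "continuous_on {0<..<1} \<tau>"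
    "\<And>t. \<tau> (\<sigma> t) = t" "\<And>s. s \<in> {0<..<1} \<Longrightarrow> \<sigma> (\<tau> s) = s"
proof -
  define \<sigma> where "\<sigma> t = arctan t / pi + 1 / 2" for t :: real
  define \<tau> where "\<tau> s = tan (pi * (s - 1 / 2))" for s :: real
  have bounds: "- (pi / 2) < pi * (s - 1 / 2)" "pi * (s - 1 / 2) < pi / 2" if "s \<in> {0<..<1}" for s
    using that by (auto simp: algebra_simps)
  have \<sigma>\<tau>: "\<sigma> (\<tau> s) = s" if "s \<in> {0<..<1}" for s
    using arctan_tan[OF bounds[OF that]] by (simp add: \<sigma>_def \<tau>_def)
  have \<sigma>_in: "\<sigma> t \<in> {0<..<1}" for t
    using arctan_lbound[of t] arctan_ubound[of t] by (auto simp: \<sigma>_def field_simps)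
  show ?thesis
  proof
    show "continuous_on UNIV \<sigma>"
      unfolding \<sigma>_def by (intro continuous_intros) auto
    show "strict_mono \<sigma>"
      by (rule strict_monoI) (simp add: \<sigma>_def divide_strict_right_mono arctan_monotone)
    show "range \<sigma> = {0<..<1}"
      using \<sigma>_in \<sigma>\<tau> by (metis (no_types, lifting) image_subsetI rangeI subsetI subset_antisym)
    have "cos (pi * (s - 1 / 2)) \<noteq> 0" if "s \<in> {0<..<1}" for s
      using cos_gt_zero_pi[OF bounds[OF that]] by simp
    then show "continuous_on {0<..<1} \<tau>"
      unfolding \<tau>_def by (intro continuous_intros) auto
    show "\<tau> (\<sigma> t) = t" for t
      by (simp add: \<sigma>_def \<tau>_def tan_arctan)
  qed (rule \<sigma>\<tau>)
qed

context oriented_graph_map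
begin

text \<open>
  If \<open>d\<close> becomes trivial in the Bruschlinsky group of the inverse limit, then it is already trivial
  at a finite stage \<open>X\<close>, and on a wedge of circles the winding numbers are invariants.
\<close>
lemma winding_number_trivial:
  assumes V: "V = {v}" and H: "continuous_map Xbar euclideanreal H"
    and d: "\<And>x. x \<in> topspace Xbar \<Longrightarrow> winding_map c d (x n) = cis (2 * pi * H x)"
  shows "\<exists>N. (bonding ^^ N) d = 0"
proof -
  obtain N H' where H': "continuous_map X euclideanreal H'"
    "\<And>x. x \<in> topspace Xbar \<Longrightarrow> norm (H x - H' (x N)) < 1 / 4"
    using approximation_by_coordinate[OF H, of "1/4"] by (simp del: real_norm_def) blast
  obtain G where G: "continuous_map X euclideanreal G"
    "\<And>z. z \<in> topspace X \<Longrightarrow> winding_map c d ((f ^^ N) z) = winding_map c ((bonding ^^ N) d) z * cis (2 * pi * G z)"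
    using winding_map_pullback_funpow[of d N] by blast
  define F where "F z = H' ((f ^^ n) z) - G z" for z
  have F: "continuous_map X euclideanreal F"
    unfolding F_def using continuous_map_compose[OF continuous_funpow H'(1), of n]
    by (intro continuous_map_diff G(1)) (simp add: o_def)
  have near: "0 < Re (winding_map c ((bonding ^^ N) d) z * cnj (cis (2 * pi * F z)))" if z: "z \<in> topspace X" for z
  proof -
    obtain x where x: "x \<in> topspace Xbar" "x (n + N) = z"
      using surj_coordinate[OF z] .
    have xn: "(f ^^ N) z = x n" and xN: "(f ^^ n) z = x N"
      using coordinate_funpow[OF x(1), of N n] coordinate_funpow[OF x(1), of n N] x(2)
      by (simp_all add: add.commute[of N n])
    have "winding_map c ((bonding ^^ N) d) z * cis (2 * pi * G z) = cis (2 * pi * H x)"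
      using G(2)[OF z] d[OF x(1)] xn by simp
    then have "winding_map c ((bonding ^^ N) d) z = cis (2 * pi * H x) / cis (2 * pi * G z)"
      by (simp add: eq_divide_eq)
    then have "winding_map c ((bonding ^^ N) d) z * cnj (cis (2 * pi * F z)) =
        cis (2 * pi * H x) / cis (2 * pi * G z) / cis (2 * pi * F z)"
      by (simp add: cis_cnj divide_inverse)
    also have "\<dots> = cis (2 * pi * (H x - G z - F z))"
      by (simp only: cis_divide right_diff_distrib)
    also have "H x - G z - F z = H x - H' (x N)"
      by (simp add: F_def xN)
    finally have "Re (winding_map c ((bonding ^^ N) d) z * cnj (cis (2 * pi * F z))) = cos (2 * pi * (H x - H' (x N)))"
      by simp
    moreover have "\<bar>2 * pi * (H x - H' (x N))\<bar> < pi / 2"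
      using H'(2)[OF x(1)] by (simp add: abs_mult)
    then have "0 < cos (2 * pi * (H x - H' (x N)))"
      by (intro cos_gt_zero_pi) linarith+
    ultimately show ?thesis
      by (simp only:)
  qed
  obtain \<theta> where \<theta>: "continuous_map X euclideanreal \<theta>"
    "\<And>z. z \<in> topspace X \<Longrightarrow> winding_map c ((bonding ^^ N) d) z = cis (2 * pi * F z) * cis (2 * pi * \<theta> z)"
    using nearby_circle_maps[OF continuous_winding_map circle_map_cis[OF F] near] by blast
  define L where "L z = F z + \<theta> z" for z
  have L: "continuous_map X euclideanreal L"
    unfolding L_def by (intro continuous_map_add F \<theta>(1))
  have "((bonding ^^ N) d) $ e = 0" for e
  proof -
    have "L (c e 1) - L (c e 0) = 1 * of_int (((bonding ^^ N) d) $ e) - 0 * of_int (((bonding ^^ N) d) $ e)"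
    proof (rule angle_difference_constant[where S = "{0..1::real}"])
      show "continuous_on {0..1} (\<lambda>t. L (c e t))"
        using continuous_map_compose[OF continuous_edge L, of e] by (simp add: o_def)
      show "continuous_on {0..1} (\<lambda>t. t * real_of_int (((bonding ^^ N) d) $ e))"
        by (intro continuous_intros)
      show "cis (2 * pi * L (c e t)) = cis (2 * pi * (t * real_of_int (((bonding ^^ N) d) $ e)))" if "t \<in> {0..1}" for t
        using \<theta>(2)[OF edge_in_space[OF that]] winding_map_edge[OF that] by (simp add: L_def cis_mult distrib_left)
    qed auto
    moreover have "c e 1 = c e 0"
      using edge_ends(1)[of e] edge_ends(2)[of e] V by simp
    ultimately show ?thesis by simp
  qed
  then show ?thesis
    by (auto simp: vec_eq_iff)
qed

lemma iota_inj:
  assumes V: "V = {v}"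
  shows "inj_on (iota Xbar c) (carrier (limit_group (adjacency_matrix c f)))"
proof (rule inj_onI)
  fix A B assume A: "A \<in> carrier (limit_group (adjacency_matrix c f))" and B: "B \<in> carrier (limit_group (adjacency_matrix c f))"
    and eq: "iota Xbar c A = iota Xbar c B"
  obtain k g where Ak: "A = limit_class (adjacency_matrix c f) k g"
    using A by (rule carrier_limit_groupE)
  obtain l h where Bl: "B = limit_class (adjacency_matrix c f) l h"
    using B by (rule carrier_limit_groupE)
  define g' h' where "g' = (bonding ^^ l) g" and "h' = (bonding ^^ k) h"
  have "Br_class Xbar (\<lambda>x. winding_map c g' (x (k + l))) = Br_class Xbar (\<lambda>x. winding_map c h' (x (k + l)))"
    using eq Br_class_funpow_bonding[of g k l] Br_class_funpow_bonding[of h l k]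
    unfolding Ak Bl iota_limit_class g'_def h'_def by (simp add: add.commute[of l k])
  then obtain H where H: "continuous_map Xbar euclideanreal H"
    "\<And>x. x \<in> topspace Xbar \<Longrightarrow> winding_map c g' (x (k + l)) = winding_map c h' (x (k + l)) * cis (2 * pi * H x)"
    unfolding Br_class_eq_iff[OF circle_map_winding_coordinate circle_map_winding_coordinate] by blast
  have "winding_map c (g' - h') (x (k + l)) = cis (2 * pi * H x)" if x: "x \<in> topspace Xbar" for x
  proof -
    have "winding_map c h' (x (k + l)) * winding_map c (g' - h') (x (k + l)) =
        winding_map c h' (x (k + l)) * cis (2 * pi * H x)"
      unfolding H(2)[OF x, symmetric] winding_map_add[OF coordinate_in_space[OF x], symmetric] by simp
    moreover have "winding_map c h' (x (k + l)) \<noteq> 0"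
      using norm_winding_map[OF coordinate_in_space[OF x], of h' "k + l"] by auto
    ultimately show ?thesis by simp
  qed
  then obtain N where "(bonding ^^ N) (g' - h') = 0"
    using winding_number_trivial[OF V H(1)] by blast
  then have "(bonding ^^ N) g' = (bonding ^^ N) h'"
    using funpow_matrix_add[where M = "adjacency_matrix c f" and n = N and g = "g' - h'" and h = h'] by simp
  then have "(bonding ^^ (l + N)) g = (bonding ^^ (k + N)) h"
    unfolding g'_def h'_def funpow_funpow by (simp add: add.commute)
  then show "A = B"
    unfolding Ak Bl limit_class_eq_iff limit_rel_iff by blast
qed

text \<open>
  For large \<open>N\<close>, points with equal \<open>N\<close>-th coordinates have almost equal values of the real function
  by which the class is corrected. Along a curve that runs once through the edge \<open>e\<close> in coordinate
  \<open>k + N\<close> the angle does not decrease, so the winding number of \<open>e\<close> exceeds \<open>- 1\<close>.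
\<close>
lemma Br_cone_subset:
  assumes V: "V = {v}"
  shows "Br_cone Xbar X c \<subseteq> iota Xbar c ` limit_cone (adjacency_matrix c f)"
proof
  fix A assume "A \<in> Br_cone Xbar X c"
  then obtain \<phi> \<psi> where A: "A = Br_class Xbar \<phi>" and \<phi>: "\<phi> \<in> carrier (circle_maps Xbar)" and \<psi>: "\<psi> \<in> exp_maps Xbar"
    and clockwise: "\<And>\<gamma>. op_curve Xbar X c \<gamma> \<Longrightarrow> never_clockwise (\<lambda>t. (\<phi> \<otimes>\<^bsub>circle_maps Xbar\<^esub> \<psi>) (\<gamma> t))"
    unfolding Br_cone_def by blast
  obtain h where h: "continuous_map Xbar euclideanreal h" "\<psi> = (\<lambda>x\<in>topspace Xbar. cis (2 * pi * h x))"
    using \<psi> unfolding exp_maps_def by blast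
  define \<Phi> where "\<Phi> x = \<phi> x * cis (2 * pi * h x)" for x
  have \<phi>_circle: "circle_map Xbar \<phi>"
    using \<phi> by (simp add: carrier_circle_maps_iff)
  then have \<Phi>_circle: "circle_map Xbar \<Phi>"
    unfolding \<Phi>_def by (intro circle_map_mult circle_map_cis h(1))
  have A_\<Phi>: "A = Br_class Xbar \<Phi>"
  proof -
    have "Br_class Xbar \<Phi> = Br_class Xbar \<phi>"
      unfolding Br_class_eq_iff[OF \<Phi>_circle \<phi>_circle] using h(1) by (auto simp: \<Phi>_def)
    then show ?thesis by (simp add: A)
  qed
  obtain k g where "Br_class Xbar \<Phi> = Br_class Xbar (\<lambda>x. winding_map c g (x k))"
    using \<Phi>_circle by (rule Br_class_from_coordinate)
  then obtain H where H: "continuous_map Xbar euclideanreal H"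
    "\<And>x. x \<in> topspace Xbar \<Longrightarrow> \<Phi> x = winding_map c g (x k) * cis (2 * pi * H x)"
    and A_g: "A = iota Xbar c (limit_class (adjacency_matrix c f) k g)"
    unfolding A_\<Phi> iota_limit_class Br_class_eq_iff[OF \<Phi>_circle circle_map_winding_coordinate] by blast
  obtain N H' where H': "continuous_map X euclideanreal H'"
    "\<And>x. x \<in> topspace Xbar \<Longrightarrow> norm (H x - H' (x N)) < 1 / 2"
    using approximation_by_coordinate[OF H(1), of "1/2"] by (simp del: real_norm_def) blast
  obtain G where G: "continuous_map X euclideanreal G"
    "\<And>z. z \<in> topspace X \<Longrightarrow> winding_map c g ((f ^^ N) z) = winding_map c ((bonding ^^ N) g) z * cis (2 * pi * G z)"
    using winding_map_pullback_funpow[of g N] by blast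
  define g' where "g' = (bonding ^^ N) g"
  have "0 \<le> g' $ e" for e
  proof -
    obtain \<Gamma> where \<Gamma>: "continuous_map (top_of_set {0..1}) Xbar \<Gamma>" "\<And>n. op_path X c {0..1} (\<lambda>t. \<Gamma> t n)"
      "\<And>t. t \<in> {0..1} \<Longrightarrow> \<Gamma> t (k + N) = c e t"
      using curve_through_edge[of "k + N" e] by blast
    obtain \<sigma> \<tau> :: "real \<Rightarrow> real" where \<sigma>: "continuous_on UNIV \<sigma>" "strict_mono \<sigma>" "range \<sigma> = {0<..<1}"
      and \<tau>: "continuous_on {0<..<1} \<tau>" "\<And>t. \<tau> (\<sigma> t) = t" "\<And>s. s \<in> {0<..<1} \<Longrightarrow> \<sigma> (\<tau> s) = s"
      using open_unit_interval_parametrization by blast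
    have \<Gamma>_in: "\<Gamma> s \<in> topspace Xbar" if "s \<in> {0..1}" for s
      using continuous_map_image_subset_topspace[OF \<Gamma>(1)] that by auto
    have \<sigma>_in: "\<sigma> t \<in> {0..1}" for t
      using \<sigma>(3) by (metis atLeastAtMost_iff greaterThanLessThan_iff less_imp_le rangeI)
    obtain \<theta> where \<theta>: "continuous_on UNIV \<theta>" "mono \<theta>"
      "\<And>t. (\<phi> \<otimes>\<^bsub>circle_maps Xbar\<^esub> \<psi>) (\<Gamma> (\<sigma> t)) = cis (2 * pi * \<theta> t)"
      using clockwise[OF op_curve_through_edge[OF \<Gamma> \<sigma> \<tau>(1,2)]] unfolding never_clockwise_def by blast
    define L where "L s = s * of_int (g' $ e) + G (c e s) + H (\<Gamma> s)" for s
    have L_cont: "continuous_on {0..1} L"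
      using continuous_map_compose[OF continuous_edge G(1), of e] continuous_map_compose[OF \<Gamma>(1) H(1)]
      unfolding L_def by (intro continuous_intros) (simp_all add: o_def)
    have L: "\<Phi> (\<Gamma> s) = cis (2 * pi * L s)" if s: "s \<in> {0..1}" for s
    proof -
      have "\<Phi> (\<Gamma> s) = winding_map c g (\<Gamma> s k) * cis (2 * pi * H (\<Gamma> s))"
        by (rule H(2)[OF \<Gamma>_in[OF s]])
      also have "\<Gamma> s k = (f ^^ N) (c e s)"
        using coordinate_funpow[OF \<Gamma>_in[OF s], of N k] \<Gamma>(3)[OF s] by simp
      finally show ?thesis
        using G(2)[OF edge_in_space[OF s]] winding_map_edge[OF s]
        by (simp add: L_def g'_def[symmetric] cis_mult distrib_left)
    qed
    have L_mono: "L s \<le> L s'" if ss': "s \<in> {0<..<1}" "s' \<in> {0<..<1}" "s \<le> s'" for s s'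
    proof -
      have "cis (2 * pi * \<theta> t) = cis (2 * pi * L (\<sigma> t))" for t
        using \<theta>(3)[of t] L[OF \<sigma>_in, of t] \<Gamma>_in[OF \<sigma>_in, of t] by (simp add: mult_circle_maps h(2) \<Phi>_def)
      then have "\<theta> (\<tau> s') - \<theta> (\<tau> s) = L (\<sigma> (\<tau> s')) - L (\<sigma> (\<tau> s))"
      proof (rule angle_difference_constant[OF connected_UNIV \<theta>(1), rotated])
        show "continuous_on UNIV (\<lambda>t. L (\<sigma> t))"
          using \<sigma>_in by (intro continuous_on_compose2[OF L_cont \<sigma>(1)]) auto
      qed auto
      moreover have "\<tau> s \<le> \<tau> s'"
        using strict_mono_less_eq[OF \<sigma>(2), of "\<tau> s" "\<tau> s'"] \<tau>(3) ss' by simp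
      then have "\<theta> (\<tau> s) \<le> \<theta> (\<tau> s')"
        by (rule monoD[OF \<theta>(2)])
      ultimately show ?thesis
        using \<tau>(3) ss' by simp
    qed
    have "0 \<le> L (1 - 0) - L 0"
    proof (rule continuous_ge_on_closure[where S = "{0<..<1/2}" and f = "\<lambda>s. L (1 - s) - L s"])
      show "continuous_on (closure {0<..<1 / 2}) (\<lambda>s. L (1 - s) - L s)"
        by (intro continuous_intros continuous_on_compose2[OF L_cont]) auto
      show "(0::real) \<in> closure {0<..<1 / 2}"
        by simp
      show "0 \<le> L (1 - s) - L s" if "s \<in> {0<..<1 / 2}" for s
        using L_mono[of s "1 - s"] that by simp
    qed
    moreover have ends: "c e 1 = c e 0"
      using edge_ends(1)[of e] edge_ends(2)[of e] V by simp
    ultimately have "0 \<le> of_int (g' $ e) + (H (\<Gamma> 1) - H (\<Gamma> 0))"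
      by (simp add: L_def)
    moreover have "\<Gamma> 1 N = \<Gamma> 0 N"
      using coordinate_funpow[OF \<Gamma>_in[of 0], of k N] coordinate_funpow[OF \<Gamma>_in[of 1], of k N]
        \<Gamma>(3)[of 0] \<Gamma>(3)[of 1] ends by (simp add: add.commute)
    then have "\<bar>H (\<Gamma> 1) - H (\<Gamma> 0)\<bar> < 1"
      using H'(2)[OF \<Gamma>_in[of 0]] H'(2)[OF \<Gamma>_in[of 1]] by (simp add: abs_if split: if_splits)
    ultimately have "- 1 < real_of_int (g' $ e)"
      by linarith
    then show ?thesis by linarith
  qed
  moreover have "limit_class (adjacency_matrix c f) k g = limit_class (adjacency_matrix c f) (k + N) g'"
    unfolding limit_class_eq_iff limit_rel_iff g'_def funpow_funpow
    by (rule exI[of _ 0]) simp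
  ultimately have "limit_class (adjacency_matrix c f) k g \<in> limit_cone (adjacency_matrix c f)"
    unfolding limit_cone_def by blast
  then show "A \<in> iota Xbar c ` limit_cone (adjacency_matrix c f)"
    unfolding A_g by (rule imageI)
qed

end

lemma (in solenoid_presentation) surj_f: "f ` topspace X = topspace X"
proof (rule ccontr)
  assume ne: "f ` topspace X \<noteq> topspace X"
  have sub: "f ` topspace X \<subseteq> topspace X"
    by (rule continuous_map_image_subset_topspace[OF continuous_f])
  define U where "U = topspace X - f ` topspace X"
  have "compactin X (f ` topspace X)"
    using compact_X continuous_f image_compactin unfolding compact_space_def by blast
  then have "openin X U"
    unfolding U_def using Hausdorff compactin_imp_closedin by blast
  moreover obtain x where "x \<in> U"
    using ne sub by (auto simp: U_def)
  moreover from this have "x \<in> topspace X"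
    by (simp add: U_def)
  ultimately obtain n where n: "n > 0" "(f ^^ n) ` U \<inter> U \<noteq> {}"
    using nonwandering unfolding all_nonwandering_def by blast
  then obtain y where y: "y \<in> U" "(f ^^ n) y \<in> U"
    by blast
  have "(f ^^ m) y \<in> topspace X" for m
    using y(1) sub by (induction m) (auto simp: U_def)
  moreover obtain m where "n = Suc m"
    using n(1) gr0_implies_Suc by blast
  ultimately have "(f ^^ n) y \<in> f ` topspace X"
    by simp
  then show False
    using y(2) by (simp add: U_def)
qed

theorem proposition4p1:
  fixes X :: "'a topology" and V :: "'a set" and c :: "'e::finite \<Rightarrow> real \<Rightarrow> 'a"
    and f :: "'a \<Rightarrow> 'a" and Xbar :: "(nat \<Rightarrow> 'a) topology"
    and fbar :: "(nat \<Rightarrow> 'a) \<Rightarrow> (nat \<Rightarrow> 'a)" and M :: "int ^ 'e ^ 'e"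
  assumes "branched_solenoid Xbar fbar X V c f"
    and "orientation_preserving X c f"
    and "M = adjacency_matrix c f"
  shows "(\<forall>k g. iota Xbar c (limit_class M k g) = Br_class Xbar (\<lambda>x. winding_map c g (x k))) \<and>
    ordered_group_epi (limit_group M) (limit_cone M) (Br Xbar) (Br_cone Xbar X c) (iota Xbar c) \<and>
    (elementary V f \<longrightarrow>
      ordered_group_iso (limit_group M) (limit_cone M) (Br Xbar) (Br_cone Xbar X c) (iota Xbar c))"
proof -
  have "solenoid_presentation X V c f" and Xbar: "Xbar = inverse_limit X f"
    using assms(1) by (auto simp: branched_solenoid_def)
  then interpret solenoid_presentation X V c f
    by simp
  interpret oriented_graph_map X V c f
    by unfold_locales (use compact_X Hausdorff continuous_f surj_f Markov assms(2) in auto)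
  have epi: "ordered_group_epi (limit_group M) (limit_cone M) (Br Xbar) (Br_cone Xbar X c) (iota Xbar c)"
    unfolding ordered_group_epi_def Xbar assms(3) using iota_group_hom iota_epi iota_cone by blast
  moreover have "ordered_group_iso (limit_group M) (limit_cone M) (Br Xbar) (Br_cone Xbar X c) (iota Xbar c)"
    if el: "elementary V f"
  proof -
    obtain v where V: "V = {v}"
      using el by (auto simp: elementary_def)
    have "iota Xbar c \<in> iso (limit_group M) (Br Xbar)"
      using iota_inj[OF V] iota_epi unfolding Xbar assms(3)
      by (auto simp: iso_def epi_def bij_betw_def)
    then show ?thesis
      unfolding ordered_group_iso_def using epi Br_cone_subset[OF V]
      by (auto simp: ordered_group_epi_def Xbar assms(3))
  qed
  ultimately show ?thesis
    using iota_limit_class unfolding Xbar assms(3) by blast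
qed

end
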